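(* For every constant $c>0$ there exists an increasing sequence of real numbers $(x_n)_{n\ge1}$ with $x_{n+1}-x_n\ge1$ for all $n$, such that, with $\gamma_N=\frac{\log N\,(\log\log N)^{1+c}}{N}$, $E_{N,\gamma_N}\gg N^3$, and such that for Lebesgue-almost every $\alpha\in\mathbb{R}$ the sequence $(\alpha x_n)_{n\ge1}$ has Poissonian $k$-level correlation for every integer $k\ge2$.
   Context: For a real sequence $(x_n)$, $N\ge1$ and $\gamma>0$, the additive energy at scale $\gamma$ is $E_{N,\gamma}=\#\{1\le a,b,c,d\le N : |x_a+x_b-x_c-x_d|<\gamma\}$. For an integer $k\ge2$, let $\mathcal{X}_k(N)$ be the set of $k$-tuples $(a_1,\dots,a_k)$ of distinct integers in $\{1,\dots,N\}$. For $s=(s_1,\dots,s_{2k-2})\in\mathbb{R}^{2k-2}$ with $s_{2i-1}<s_{2i}$ for $1\le i<k$, let $\mathbb{1}_{s,N}(y_1,\dots,y_{k-1})$ be the indicator that for each $i$, $y_i$ lies modulo 1 in the interval $[s_{2i-1}/N,s_{2i}/N]$ (i.e. $y_i\in[s_{2i-1}/N,s_{2i}/N]+\mathbb{Z}$). A real sequence $(y_n)$ has Poissonian $k$-level correlation if for every such $s$, $$\lim_{N\to\infty}\frac1N\sum_{a\in\mathcal{X}_k(N)}\mathbb{1}_{s,N}(y_{a_1}-y_{a_2},y_{a_1}-y_{a_3},\dots,y_{a_1}-y_{a_k})=\prod_{i=1}^{k-1}(s_{2i}-s_{2i-1}).$$ *)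

theory Defs
  imports "HOL-Analysis.Analysis"
begin

definition additive_energy :: "(nat \<Rightarrow> real) \<Rightarrow> nat \<Rightarrow> real \<Rightarrow> nat" where
  "additive_energy x N \<gamma> =
     card {(a, b, c, d). a \<in> {1..N} \<and> b \<in> {1..N} \<and> c \<in> {1..N} \<and> d \<in> {1..N}
                        \<and> \<bar>x a + x b - x c - x d\<bar> < \<gamma>}"

definition gammaN :: "real \<Rightarrow> nat \<Rightarrow> real" where
  "gammaN c N = ln (real N) * (ln (ln (real N))) powr (1 + c) / real N"

text \<open>k-tuples of distinct integers in {1..N}, as lists (a_1,...,a_k) = [as!0, ..., as!(k-1)].\<close>
definition tuples :: "nat \<Rightarrow> nat \<Rightarrow> nat list set" where
  "tuples k N = {as. length as = k \<and> distinct as \<and> set as \<subseteq> {1..N}}"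

definition in_mod1 :: "real \<Rightarrow> real \<Rightarrow> real \<Rightarrow> bool" where
  "in_mod1 y lo hi \<longleftrightarrow> (\<exists>m::int. lo \<le> y - of_int m \<and> y - of_int m \<le> hi)"

definition admissible :: "nat \<Rightarrow> (nat \<Rightarrow> real) \<Rightarrow> bool" where
  "admissible k s \<longleftrightarrow> (\<forall>i. 1 \<le> i \<and> i < k \<longrightarrow> s (2*i - 1) < s (2*i))"

definition corr_count :: "nat \<Rightarrow> (nat \<Rightarrow> real) \<Rightarrow> (nat \<Rightarrow> real) \<Rightarrow> nat \<Rightarrow> nat" where
  "corr_count k y s N = card {as \<in> tuples k N.
      \<forall>i\<in>{1..k-1}. in_mod1 (y (as ! 0) - y (as ! i)) (s (2*i - 1) / real N) (s (2*i) / real N)}"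

definition poissonian_corr :: "nat \<Rightarrow> (nat \<Rightarrow> real) \<Rightarrow> bool" where
  "poissonian_corr k y \<longleftrightarrow>
     (\<forall>s. admissible k s \<longrightarrow>
        (\<lambda>N. real (corr_count k y s N) / real N)
          \<longlonglongrightarrow> (\<Prod>i\<in>{1..k-1}. s (2*i) - s (2*i - 1)))"

end

theory Submission
  imports Defs "HOL-Probability.Probability" "HOL-Real_Asymp.Real_Asymp"
begin

text \<open>Take \<open>x n = 2 n + G j u n\<close> for \<open>2 ^ j \<le> n < 2 ^ (j + 1)\<close>, with independent \<open>u n\<close> uniform in
  \<open>[0, 1]\<close> and \<open>G j\<close> slightly smaller than \<open>gammaN\<close> at \<open>2 ^ j\<close>. Inside a dyadic block this is an
  arithmetic progression up to an error below \<open>gammaN\<close>, so the energy is cubic.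

  For almost every \<open>\<alpha>\<close> the convergence half of Khinchin's theorem bounds the distance of \<open>2 q \<alpha>\<close>
  from the integers from below, so Dirichlet's theorem at level \<open>h N\<close> returns a denominator \<open>q\<close> that
  is not much smaller than \<open>N\<close>. Cutting the rotation into periods of length \<open>q\<close> shows that the points
  \<open>2 \<alpha> n\<close> with \<open>n \<le> N\<close> are equidistributed in arcs of length \<open>\<alpha> G j\<close>. Hence, whatever the position
  of one point, the expected number of the other perturbed points in an arc of length \<open>t / N\<close> next
  to it tends to \<open>t\<close>, and integrating out one perturbation at a time yields the expected correlation
  sums. Disjoint tuples are independent, so the normalised sums have variance \<open>O(1 / N)\<close> and converge
  almost surely along squares; monotonicity fills the gaps. Fubini's theorem finally exchanges almost
  every \<open>\<alpha>\<close> and almost every \<open>u\<close>.\<close>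

section \<open>Arcs of the circle\<close>

lemma in_mod1I: "lo \<le> y \<Longrightarrow> y \<le> hi \<Longrightarrow> in_mod1 y lo hi"
  unfolding in_mod1_def by (intro exI[of _ 0]) simp

lemma in_mod1_mono: "in_mod1 y lo hi \<Longrightarrow> lo' \<le> lo \<Longrightarrow> hi \<le> hi' \<Longrightarrow> in_mod1 y lo' hi'"
  unfolding in_mod1_def by (meson order_trans)

lemma in_mod1_add:
  assumes "in_mod1 y lo hi" "in_mod1 y' lo' hi'"
  shows "in_mod1 (y + y') (lo + lo') (hi + hi')"
proof -
  obtain m m' :: int where "lo \<le> y - of_int m" "y - of_int m \<le> hi" "lo' \<le> y' - of_int m'"
    "y' - of_int m' \<le> hi'"
    using assms unfolding in_mod1_def by blast
  then show ?thesis unfolding in_mod1_def by (intro exI[of _ "m + m'"]) auto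
qed

lemma in_mod1_perturb:
  assumes "in_mod1 y lo hi" "\<bar>z - y\<bar> \<le> e"
  shows "in_mod1 z (lo - e) (hi + e)"
proof -
  have "in_mod1 (z - y) (- e) e"
    using assms(2) by (intro in_mod1I) auto
  from in_mod1_add[OF assms(1) this] show ?thesis by simp
qed

lemma in_mod1_add_iff: "in_mod1 (y + c) lo hi \<longleftrightarrow> in_mod1 y (lo - c) (hi - c)"
  unfolding in_mod1_def by (simp add: algebra_simps)

lemma in_mod1_add_of_int: "in_mod1 (y + of_int n) lo hi \<longleftrightarrow> in_mod1 y lo hi"
proof -
  have "in_mod1 (y + of_int n) lo hi" if "in_mod1 y lo hi" for y n
  proof -
    obtain m :: int where "lo \<le> y - of_int m" "y - of_int m \<le> hi"
      using \<open>in_mod1 y lo hi\<close> unfolding in_mod1_def by blast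
    then show ?thesis unfolding in_mod1_def by (intro exI[of _ "m + n"]) auto
  qed
  from this[of y n] this[of "y + of_int n" "- n"] show ?thesis by auto
qed

lemma in_mod1_uminus: "in_mod1 (- y) lo hi \<longleftrightarrow> in_mod1 y (- hi) (- lo)"
proof -
  have "in_mod1 (- y) lo hi" if "in_mod1 y (- hi) (- lo)" for y lo hi
  proof -
    obtain m :: int where "- hi \<le> y - of_int m" "y - of_int m \<le> - lo"
      using \<open>in_mod1 y (- hi) (- lo)\<close> unfolding in_mod1_def by blast
    then show ?thesis unfolding in_mod1_def by (intro exI[of _ "- m"]) auto
  qed
  from this[of y hi lo] this[of "- y" "- lo" "- hi"] show ?thesis by auto
qed

lemma measurable_in_mod1 [measurable (raw)]:
  assumes [measurable]: "f \<in> borel_measurable M"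
  shows "Measurable.pred M (\<lambda>x. in_mod1 (f x) lo hi)"
  unfolding in_mod1_def by measurable

definition arc_count :: "(nat \<Rightarrow> real) \<Rightarrow> nat set \<Rightarrow> real \<Rightarrow> real \<Rightarrow> nat" where
  "arc_count x I lo hi = card {b \<in> I. in_mod1 (x b) lo hi}"

lemma arc_count_eq_sum:
  assumes "finite I"
  shows "real (arc_count x I lo hi) = (\<Sum>b\<in>I. of_bool (in_mod1 (x b) lo hi))"
  using assms by (simp add: arc_count_def of_bool_def sum.If_cases Int_def)

lemma arc_count_shift: "arc_count (\<lambda>b. x b + c) I lo hi = arc_count x I (lo - c) (hi - c)"
  by (simp add: arc_count_def in_mod1_add_iff)

lemma arc_count_reindex:
  assumes "bij_betw f I J"
  shows "arc_count x J lo hi = arc_count (\<lambda>b. x (f b)) I lo hi"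
proof -
  have "{b \<in> J. in_mod1 (x b) lo hi} = f ` {b \<in> I. in_mod1 (x (f b)) lo hi}"
    using bij_betw_imp_surj_on[OF assms] by blast
  moreover have "inj_on f {b \<in> I. in_mod1 (x (f b)) lo hi}"
    using bij_betw_imp_inj_on[OF assms] by (rule inj_on_subset) blast
  ultimately show ?thesis by (simp add: arc_count_def card_image)
qed

lemma arc_count_perturb:
  assumes "finite I" "\<And>b. b \<in> I \<Longrightarrow> \<bar>y b - x b\<bar> \<le> e"
  shows "arc_count x I lo hi \<le> arc_count y I (lo - e) (hi + e)"
  unfolding arc_count_def using assms by (intro card_mono) (auto intro: in_mod1_perturb)

section \<open>Discrepancy of a rotation\<close>

lemma card_int_interval_bounds:
  fixes a b :: real
  shows "b - a - 1 \<le> real (card {\<lceil>a\<rceil>..\<lfloor>b\<rfloor>})"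
    and "a \<le> b \<Longrightarrow> real (card {\<lceil>a\<rceil>..\<lfloor>b\<rfloor>}) \<le> b - a + 1"
  by (simp; linarith)+

lemma residues_in_arc_eq_image:
  assumes q_pos: "q > 0"
  shows "{r. r < q \<and> in_mod1 (real r / real q) lo hi}
      = (\<lambda>t. nat (t mod int q)) ` {\<lceil>real q * lo\<rceil>..\<lfloor>real q * hi\<rfloor>}"
proof (intro set_eqI iffI)
  fix r assume r_mem: "r \<in> {r. r < q \<and> in_mod1 (real r / real q) lo hi}"
  then obtain m :: int where m_bounds: "lo \<le> real r / real q - of_int m"
    "real r / real q - of_int m \<le> hi"
    unfolding in_mod1_def by blast
  define t where "t = int r - m * int q"
  have "real q * lo \<le> of_int t" "of_int t \<le> real q * hi"
    using m_bounds q_pos by (auto simp: t_def field_simps)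
  moreover have "nat (t mod int q) = r"
    using r_mem by (simp add: t_def mod_diff_eq[symmetric] flip: of_nat_mod)
  ultimately show "r \<in> (\<lambda>t. nat (t mod int q)) ` {\<lceil>real q * lo\<rceil>..\<lfloor>real q * hi\<rfloor>}"
    by (intro image_eqI[of _ _ t]) (auto simp: ceiling_le_iff le_floor_iff)
next
  fix r assume "r \<in> (\<lambda>t. nat (t mod int q)) ` {\<lceil>real q * lo\<rceil>..\<lfloor>real q * hi\<rfloor>}"
  then obtain t where t_bounds: "real q * lo \<le> of_int t" "of_int t \<le> real q * hi"
    and r_eq: "r = nat (t mod int q)"
    by (auto simp: ceiling_le_iff le_floor_iff)
  have "int r = t - t div int q * int q" using q_pos r_eq by (simp add: minus_div_mult_eq_mod)
  then have "real r = of_int t - of_int (t div int q) * real q"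
    by (metis of_int_diff of_int_mult of_int_of_nat_eq)
  then have "real r / real q = of_int t / real q + of_int (- (t div int q))"
    using q_pos by (simp add: field_simps)
  moreover have "in_mod1 (of_int t / real q) lo hi"
    using t_bounds q_pos by (intro in_mod1I) (auto simp: field_simps)
  ultimately have "in_mod1 (real r / real q) lo hi" by (simp only: in_mod1_add_of_int)
  moreover have "r < q" using q_pos r_eq by (simp add: nat_less_iff)
  ultimately show "r \<in> {r. r < q \<and> in_mod1 (real r / real q) lo hi}" by blast
qed

lemma inj_on_mod_int_interval:
  assumes "b - a < real q"
  shows "inj_on (\<lambda>t. nat (t mod int q)) {\<lceil>a\<rceil>..\<lfloor>b\<rfloor>}"
proof (rule inj_onI)
  fix s t assume s_t_in: "s \<in> {\<lceil>a\<rceil>..\<lfloor>b\<rfloor>}" "t \<in> {\<lceil>a\<rceil>..\<lfloor>b\<rfloor>}"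
    and mod_eq: "nat (s mod int q) = nat (t mod int q)"
  have q_pos: "q > 0"
  proof (rule ccontr)
    assume "\<not> q > 0"
    with assms s_t_in show False by simp linarith
  qed
  have "\<bar>s - t\<bar> < int q" using s_t_in assms by (simp add: abs_less_iff) linarith
  moreover have "s mod int q = t mod int q" using mod_eq q_pos by (simp add: nat_eq_iff)
  then have "int q dvd s - t" by (simp add: mod_eq_dvd_iff)
  ultimately show "s = t" using zdvd_not_zless[of "\<bar>s - t\<bar>" "int q"] by auto
qed

lemma arc_count_residues_bounds:
  assumes q_pos: "q > 0"
  shows "lo \<le> hi \<Longrightarrow> real (arc_count (\<lambda>r. real r / real q) {..<q} lo hi) \<le> real q * (hi - lo) + 1"
    and "hi - lo < 1 \<Longrightarrow> real q * (hi - lo) - 1 \<le> real (arc_count (\<lambda>r. real r / real q) {..<q} lo hi)"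
proof -
  let ?T = "{\<lceil>real q * lo\<rceil>..\<lfloor>real q * hi\<rfloor>}"
  have count_eq: "arc_count (\<lambda>r. real r / real q) {..<q} lo hi
      = card ((\<lambda>t. nat (t mod int q)) ` ?T)"
    by (simp add: arc_count_def flip: residues_in_arc_eq_image[OF q_pos])
  show "real (arc_count (\<lambda>r. real r / real q) {..<q} lo hi) \<le> real q * (hi - lo) + 1" if "lo \<le> hi"
  proof -
    have "card ((\<lambda>t. nat (t mod int q)) ` ?T) \<le> card ?T" by (rule card_image_le) simp
    moreover have "real (card ?T) \<le> real q * hi - real q * lo + 1"
      using that by (intro card_int_interval_bounds mult_left_mono) auto
    ultimately show ?thesis unfolding count_eq right_diff_distrib by linarith
  qed
  show "real q * (hi - lo) - 1 \<le> real (arc_count (\<lambda>r. real r / real q) {..<q} lo hi)"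
    if "hi - lo < 1"
  proof -
    have "real q * hi - real q * lo < real q"
      using mult_strict_left_mono[OF that, of "real q"] q_pos by (simp add: right_diff_distrib)
    then have "card ((\<lambda>t. nat (t mod int q)) ` ?T) = card ?T"
      by (intro card_image inj_on_mod_int_interval)
    then show ?thesis unfolding count_eq right_diff_distrib by (simp only: card_int_interval_bounds)
  qed
qed

lemma bij_betw_mult_coprime_mod:
  assumes q_pos: "q > 0" and coprime: "coprime p (int q)"
  shows "bij_betw (\<lambda>r. nat (int r * p mod int q)) {..<q} {..<q}"
proof -
  let ?f = "\<lambda>r. nat (int r * p mod int q)"
  have "inj_on ?f {..<q}"
  proof (rule inj_onI)
    fix r s assume r_s_eq: "r \<in> {..<q}" "s \<in> {..<q}" "?f r = ?f s"
    then have "int r * p mod int q = int s * p mod int q" using q_pos by (simp add: nat_eq_iff)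
    then have "int q dvd (int r - int s) * p" by (simp add: mod_eq_dvd_iff left_diff_distrib)
    then have "int r mod int q = int s mod int q"
      using coprime by (simp add: mod_eq_dvd_iff coprime_commute coprime_dvd_mult_left_iff)
    then show "r = s" using r_s_eq(1,2) by simp
  qed
  moreover have "?f ` {..<q} \<subseteq> {..<q}" using q_pos by (auto simp: nat_less_iff)
  ultimately show ?thesis by (simp add: bij_betw_def endo_inj_surj)
qed

lemma arc_count_residues_mult_coprime:
  assumes q_pos: "q > 0" and coprime: "coprime p (int q)"
  shows "arc_count (\<lambda>r. real r * of_int p / real q) {..<q} lo hi
      = arc_count (\<lambda>r. real r / real q) {..<q} lo hi"
proof -
  have "real (nat (int r * p mod int q)) / real q
      = real r * of_int p / real q + of_int (- (int r * p div int q))" for r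
  proof -
    have "real (nat (int r * p mod int q)) = of_int (int r * p - int r * p div int q * int q)"
      using q_pos by (simp add: minus_div_mult_eq_mod of_nat_nat del: of_int_diff of_int_mult)
    then show ?thesis using q_pos by (simp add: field_simps)
  qed
  then have "in_mod1 (real (nat (int r * p mod int q)) / real q) lo hi
      \<longleftrightarrow> in_mod1 (real r * of_int p / real q) lo hi" for r
    by (simp only: in_mod1_add_of_int)
  then show ?thesis
    using arc_count_reindex[OF bij_betw_mult_coprime_mod[OF q_pos coprime], of "\<lambda>r. real r / real q" lo hi]
    by (simp add: arc_count_def)
qed

definition rotation_discrepancy :: "real \<Rightarrow> real \<Rightarrow> real \<Rightarrow> nat \<Rightarrow> nat \<Rightarrow> real" where
  "rotation_discrepancy \<beta> l w m M =
     \<bar>real (arc_count (\<lambda>b. w - \<beta> * real b) {m..<m+M} 0 l) - real M * l\<bar>"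

lemma rotation_discrepancy_period:
  fixes \<beta> w l :: real and p :: int and q :: nat
  assumes q_pos: "q > 0" and coprime: "coprime p (int q)" and l_bounds: "0 \<le> l" "l < 1"
  shows "rotation_discrepancy \<beta> l w m q \<le> 2 * real q * \<bar>real q * \<beta> - of_int p\<bar> + 1"
proof -
  define \<epsilon> where "\<epsilon> = \<bar>real q * \<beta> - of_int p\<bar>"
  have \<epsilon>_nonneg: "0 \<le> \<epsilon>" by (simp add: \<epsilon>_def)
  define c where "c = w - \<beta> * real m"
  let ?x = "\<lambda>r. c - \<beta> * real r" and ?y = "\<lambda>r. real r * of_int (- p) / real q + c"
  have "bij_betw (\<lambda>r. m + r) {..<q} {m..<m+q}"
    by (rule bij_betw_byWitness[of _ "\<lambda>b. b - m"]) auto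
  then have count_eq: "arc_count (\<lambda>b. w - \<beta> * real b) {m..<m+q} 0 l = arc_count ?x {..<q} 0 l"
    by (simp add: arc_count_reindex c_def algebra_simps)
  have coprime': "coprime (- p) (int q)" using coprime by simp
  note residues = arc_count_shift arc_count_residues_mult_coprime[OF q_pos coprime']
  have near: "\<bar>?y r - ?x r\<bar> \<le> \<epsilon>" if "r \<in> {..<q}" for r
  proof -
    have "?y r - ?x r = real r / real q * (real q * \<beta> - of_int p)"
      using q_pos by (simp add: field_simps)
    also have "\<bar>\<dots>\<bar> \<le> 1 * \<epsilon>" unfolding abs_mult \<epsilon>_def using that by (intro mult_right_mono) auto
    finally show ?thesis by simp
  qed
  have "arc_count ?x {..<q} 0 l \<le> arc_count ?y {..<q} (0 - \<epsilon>) (l + \<epsilon>)"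
    using near by (intro arc_count_perturb) auto
  moreover have "real (arc_count ?y {..<q} (0 - \<epsilon>) (l + \<epsilon>))
      \<le> real q * ((l + \<epsilon> - c) - (0 - \<epsilon> - c)) + 1"
    unfolding residues using l_bounds q_pos \<epsilon>_nonneg by (intro arc_count_residues_bounds(1)) auto
  moreover have "real q * ((l - \<epsilon> - c) - (\<epsilon> - c)) - 1 \<le> real (arc_count ?y {..<q} \<epsilon> (l - \<epsilon>))"
    unfolding residues using l_bounds q_pos \<epsilon>_nonneg by (intro arc_count_residues_bounds(2)) auto
  moreover have "arc_count ?y {..<q} \<epsilon> (l - \<epsilon>) \<le> arc_count ?x {..<q} (\<epsilon> - \<epsilon>) (l - \<epsilon> + \<epsilon>)"
    using near by (intro arc_count_perturb) (auto simp: abs_minus_commute)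
  ultimately show ?thesis
    unfolding rotation_discrepancy_def count_eq \<epsilon>_def[symmetric]
    by (simp add: abs_le_iff algebra_simps)
qed

lemma sum_almost_periodic_bound:
  fixes f :: "nat \<Rightarrow> real"
  assumes q_pos: "q > 0" and f_nonneg: "\<And>b. 0 \<le> f b" and l_nonneg: "0 \<le> l"
    and period: "\<And>m. \<bar>(\<Sum>b\<in>{m..<m+q}. f b) - real q * l\<bar> \<le> e"
  shows "\<bar>(\<Sum>b\<in>{m..<m+M}. f b) - real M * l\<bar> \<le> real q * l + (real M / real q + 1) * e"
proof (induction M arbitrary: m rule: less_induct)
  case (less M)
  have e_nonneg: "0 \<le> e" using period[of 0] by linarith
  show ?case
  proof (cases "M < q")
    case True
    have "(\<Sum>b\<in>{m..<m+M}. f b) \<le> (\<Sum>b\<in>{m..<m+q}. f b)"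
      using True f_nonneg by (intro sum_mono2) auto
    moreover have "0 \<le> (\<Sum>b\<in>{m..<m+M}. f b)" by (intro sum_nonneg f_nonneg)
    moreover have "real M * l \<le> real q * l" "0 \<le> real M * l"
      using True l_nonneg by (auto intro: mult_right_mono)
    moreover have "0 \<le> real M / real q * e" using e_nonneg by simp
    ultimately show ?thesis using period[of m] unfolding distrib_right by linarith
  next
    case False
    then have q_le_M: "q \<le> M" by simp
    have "(\<Sum>b\<in>{m..<m+M}. f b) = (\<Sum>b\<in>{m..<m+q}. f b) + (\<Sum>b\<in>{m+q..<m+q+(M-q)}. f b)"
      using q_le_M by (simp add: sum.atLeastLessThan_concat)
    moreover have "\<bar>(\<Sum>b\<in>{m+q..<m+q+(M-q)}. f b) - real (M-q) * l\<bar>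
        \<le> real q * l + (real (M-q) / real q + 1) * e"
      using less.IH[of "M - q" "m + q"] q_pos q_le_M by simp
    moreover have "real (M-q) * l = real M * l - real q * l"
      "(real (M-q) / real q + 1) * e = (real M / real q + 1) * e - e"
      using q_le_M q_pos by (auto simp: of_nat_diff field_simps)
    ultimately show ?thesis using period[of m] by linarith
  qed
qed

lemma rotation_discrepancy_le_of_approx:
  assumes q_bounds: "0 < q" "real q \<le> X" and M_le_X: "real M \<le> X" and coprime: "coprime p (int q)"
    and Q_pos: "0 < Q" and approx: "\<bar>real q * \<beta> - of_int p\<bar> < 1 / Q"
    and inverse_q_le: "1 / real q \<le> P / Q" and P_ge_1: "1 \<le> P" and l_bounds: "0 \<le> l" "l < 1"
  shows "rotation_discrepancy \<beta> l w m M \<le> real q * l + 6 * X * P / Q"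
proof -
  let ?e = "2 * real q / Q + 1"
  have "rotation_discrepancy \<beta> l w m M \<le> real q * l + (real M / real q + 1) * ?e"
    unfolding rotation_discrepancy_def arc_count_eq_sum[OF finite_atLeastLessThan]
  proof (rule sum_almost_periodic_bound)
    fix m
    have "\<bar>(\<Sum>b\<in>{m..<m+q}. of_bool (in_mod1 (w - \<beta> * real b) 0 l)) - real q * l\<bar>
        \<le> 2 * real q * \<bar>real q * \<beta> - of_int p\<bar> + 1"
      using rotation_discrepancy_period[OF q_bounds(1) coprime l_bounds]
      by (simp add: rotation_discrepancy_def arc_count_eq_sum)
    also have "\<dots> \<le> 2 * real q * (1 / Q) + 1"
      using approx by (intro add_right_mono mult_left_mono) auto
    finally show "\<bar>(\<Sum>b\<in>{m..<m+q}. of_bool (in_mod1 (w - \<beta> * real b) 0 l)) - real q * l\<bar> \<le> ?e"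
      by simp
  qed (use q_bounds l_bounds in auto)
  also have "(real M / real q + 1) * ?e = (real M + real q) * (2 / Q + 1 / real q)"
    using q_bounds Q_pos by (simp add: field_simps)
  also have "\<dots> \<le> (X + X) * (2 * (P / Q) + P / Q)"
    using q_bounds M_le_X P_ge_1 Q_pos
    by (intro mult_mono add_mono inverse_q_le) (auto simp: divide_simps)
  finally show ?thesis by simp
qed

definition khinchin_type :: "(nat \<Rightarrow> real) \<Rightarrow> real \<Rightarrow> bool" where
  "khinchin_type \<psi> \<beta> \<longleftrightarrow>
     (\<forall>\<^sub>F q in sequentially. \<forall>p::int. 1 / (real q * \<psi> q) \<le> \<bar>real q * \<beta> - of_int p\<bar>)"

lemma khinchin_type_gap_pos:
  assumes khinchin: "khinchin_type \<psi> \<beta>" and \<psi>_pos: "\<And>q. 0 < \<psi> q" and r_pos: "0 < r"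
  shows "\<exists>\<delta>>0. \<forall>p::int. \<delta> \<le> \<bar>real r * \<beta> - of_int p\<bar>"
proof -
  obtain n0 where n0_bound: "\<And>q p. q \<ge> n0 \<Longrightarrow> 1 / (real q * \<psi> q) \<le> \<bar>real q * \<beta> - of_int p\<bar>"
    using khinchin unfolding khinchin_type_def eventually_sequentially by blast
  define n where "n = Suc n0"
  have n_bounds: "0 < n" "n0 \<le> n * r" using r_pos mult_le_mono2[of 1 r n] by (auto simp: n_def)
  let ?\<delta> = "1 / (real (n * r) * \<psi> (n * r)) / real n"
  have "?\<delta> \<le> \<bar>real r * \<beta> - of_int p\<bar>" for p :: int
  proof -
    have "1 / (real (n * r) * \<psi> (n * r)) \<le> \<bar>real (n * r) * \<beta> - of_int (int n * p)\<bar>"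
      by (rule n0_bound[OF n_bounds(2)])
    also have "real (n * r) * \<beta> - of_int (int n * p) = real n * (real r * \<beta> - of_int p)"
      by (simp add: algebra_simps)
    finally have "1 / (real (n * r) * \<psi> (n * r)) \<le> \<bar>real r * \<beta> - of_int p\<bar> * real n"
      by (simp only: abs_mult abs_of_nat mult.commute)
    then show ?thesis using n_bounds(1) by (simp only: pos_divide_le_eq of_nat_0_less_iff)
  qed
  moreover have "0 < ?\<delta>" using n_bounds r_pos \<psi>_pos by simp
  ultimately show ?thesis by blast
qed

lemma eventually_khinchin_type_denominator_large:
  assumes khinchin: "khinchin_type \<psi> \<beta>" and \<psi>_pos: "\<And>q. 0 < \<psi> q"
  shows "\<forall>\<^sub>F Q::nat in sequentially. \<forall>q>0. \<forall>p::int. \<bar>real q * \<beta> - of_int p\<bar> < 1 / real Q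
      \<longrightarrow> 1 / real q \<le> \<psi> q / real Q"
proof -
  obtain n where n_bound: "\<And>q p. q \<ge> n \<Longrightarrow> 1 / (real q * \<psi> q) \<le> \<bar>real q * \<beta> - of_int p\<bar>"
    using khinchin unfolding khinchin_type_def eventually_sequentially by blast
  have gap: "\<forall>\<^sub>F Q::nat in sequentially. \<forall>p::int. 1 / real Q \<le> \<bar>real q * \<beta> - of_int p\<bar>"
    if q_pos: "0 < q" for q
  proof -
    obtain \<delta> where \<delta>_gap: "\<delta> > 0" "\<And>p::int. \<delta> \<le> \<bar>real q * \<beta> - of_int p\<bar>"
      using khinchin_type_gap_pos[OF khinchin \<psi>_pos q_pos] by blast
    have "\<forall>\<^sub>F Q::nat in sequentially. 1 / real Q < \<delta>"
      by (rule order_tendstoD(2)[OF lim_1_over_n \<delta>_gap(1)])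
    then show ?thesis by eventually_elim (meson \<delta>_gap(2) less_imp_le order_trans)
  qed
  have "\<forall>\<^sub>F Q::nat in sequentially. \<forall>q\<in>{0<..<n}. \<forall>p::int. 1 / real Q \<le> \<bar>real q * \<beta> - of_int p\<bar>"
    by (rule eventually_ball_finite) (use gap in auto)
  then show ?thesis using eventually_gt_at_top[of 0]
  proof eventually_elim
    case (elim Q)
    show ?case
    proof (intro allI impI)
      fix q :: nat and p :: int assume q_pos: "0 < q"
        and approx: "\<bar>real q * \<beta> - of_int p\<bar> < 1 / real Q"
      have "n \<le> q" using elim(1) q_pos approx by (metis greaterThanLessThan_iff linorder_not_le)
      then have "1 / (real q * \<psi> q) < 1 / real Q" using n_bound[of q p] approx by linarith
      then show "1 / real q \<le> \<psi> q / real Q"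
        using \<psi>_pos[of q] q_pos elim(2) by (simp add: field_simps)
    qed
  qed
qed

lemma rotation_discrepancy_le_of_gaps:
  fixes h \<beta> l :: real and \<psi> :: "nat \<Rightarrow> real" and N :: nat
  defines "Q \<equiv> nat \<lfloor>h * real N\<rfloor>"
  assumes gaps: "\<And>q p. 0 < q \<Longrightarrow> \<bar>real q * \<beta> - of_int p\<bar> < 1 / real Q \<Longrightarrow> 1 / real q \<le> \<psi> q / real Q"
    and mono: "mono \<psi>" and \<psi>_ge_1: "1 \<le> \<psi> N" and h_bounds: "0 < h" "h \<le> 1"
    and hN_ge_2: "2 \<le> h * real N"
    and M_le_N: "M \<le> N" and l_bounds: "0 \<le> l" "l < 1"
  shows "rotation_discrepancy \<beta> l w m M \<le> h * real N * l + 12 * \<psi> N / h"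
proof -
  have Q_bounds: "real Q \<le> h * real N" "h * real N / 2 \<le> real Q" "0 < Q"
    using hN_ge_2 unfolding Q_def by (auto; linarith)+
  have N_pos: "0 < N" using hN_ge_2 by (intro gr0I) auto
  obtain p k :: int where dirichlet: "coprime p k" "0 < k" "k \<le> int Q"
    "\<bar>of_int k * \<beta> - of_int p\<bar> < 1 / real Q"
    using Dirichlet_approx_coprime[of Q \<beta>] Q_bounds(3) by blast
  define q where "q = nat k"
  have q_approx: "coprime p (int q)" "0 < q" "\<bar>real q * \<beta> - of_int p\<bar> < 1 / real Q"
    "real q \<le> h * real N"
    using dirichlet Q_bounds(1) by (auto simp: q_def)
  have "h * real N \<le> real N" using h_bounds by (simp add: mult_left_le_one_le)
  with q_approx(4) have q_le_N: "q \<le> N" by linarith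
  have "1 / real q \<le> \<psi> q / real Q" using gaps q_approx by blast
  also have "\<dots> \<le> \<psi> N / real Q" using monoD[OF mono q_le_N] by (simp add: divide_right_mono)
  finally have inverse_q_le: "1 / real q \<le> \<psi> N / real Q" .
  have "rotation_discrepancy \<beta> l w m M \<le> real q * l + 6 * real N * \<psi> N / real Q"
    using q_approx q_le_N M_le_N Q_bounds inverse_q_le \<psi>_ge_1 l_bounds
    by (intro rotation_discrepancy_le_of_approx) auto
  also have "6 * real N * \<psi> N / real Q \<le> 6 * real N * \<psi> N / (h * real N / 2)"
    using Q_bounds hN_ge_2 \<psi>_ge_1 by (intro divide_left_mono) auto
  also have "\<dots> = 12 * \<psi> N / h" using h_bounds N_pos by (simp add: field_simps)
  also have "real q * l \<le> h * real N * l" using q_approx(4) l_bounds by (intro mult_right_mono)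
  finally show ?thesis by simp
qed

text \<open>Dirichlet's theorem at level \<open>h * N j\<close> with a small \<open>h\<close> makes one period negligible against
  \<open>N j\<close> points; the Khinchin type makes the number of periods negligible against \<open>N j * l j\<close>.\<close>

lemma eventually_rotation_discrepancy_le:
  fixes l :: "nat \<Rightarrow> real" and N :: "nat \<Rightarrow> nat"
  assumes khinchin: "khinchin_type \<psi> \<beta>" and mono: "mono \<psi>" and \<psi>_ge_1: "\<And>q. 1 \<le> \<psi> q"
    and l_pos: "\<And>j. 0 < l j" and l_lim: "l \<longlonglongrightarrow> 0" and N_lim: "filterlim N at_top sequentially"
    and large: "filterlim (\<lambda>j. real (N j) * l j / \<psi> (N j)) at_top sequentially"
    and \<eta>_pos: "\<eta> > 0"
  shows "\<forall>\<^sub>F j in sequentially. \<forall>m w M. M \<le> N j \<longrightarrow>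
     rotation_discrepancy \<beta> (l j) w m M \<le> \<eta> * (real (N j) * l j)"
proof -
  define h where "h = min (\<eta> / 2) 1"
  have h_bounds: "0 < h" "h \<le> 1" "h \<le> \<eta> / 2" using \<eta>_pos by (auto simp: h_def)
  have \<psi>_pos: "0 < \<psi> q" for q using \<psi>_ge_1[of q] by linarith
  have hN_lim: "filterlim (\<lambda>j. h * real (N j)) at_top sequentially"
    using h_bounds by (intro filterlim_tendsto_pos_mult_at_top[OF tendsto_const]
        filterlim_compose[OF filterlim_real_sequentially N_lim])
  then have "filterlim (\<lambda>j. nat \<lfloor>h * real (N j)\<rfloor>) at_top sequentially"
    by (intro filterlim_compose[OF filterlim_nat_sequentially]
        filterlim_compose[OF filterlim_floor_sequentially])
  note eventually_compose_filterlim[OF eventually_khinchin_type_denominator_large[OF khinchin \<psi>_pos] this]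
  moreover have "\<forall>\<^sub>F j in sequentially. 2 \<le> h * real (N j)"
    using hN_lim by (simp add: filterlim_at_top)
  moreover have "\<forall>\<^sub>F j in sequentially. 24 / (h * \<eta>) \<le> real (N j) * l j / \<psi> (N j)"
    using large by (simp add: filterlim_at_top)
  moreover have "\<forall>\<^sub>F j in sequentially. l j < 1" using order_tendstoD(2)[OF l_lim, of 1] by simp
  ultimately show ?thesis
  proof eventually_elim
    case (elim j)
    show ?case
    proof (intro allI impI)
      fix m w and M :: nat assume M_le_N: "M \<le> N j"
      have "rotation_discrepancy \<beta> (l j) w m M \<le> h * real (N j) * l j + 12 * \<psi> (N j) / h"
        using elim h_bounds mono \<psi>_ge_1 M_le_N less_imp_le[OF l_pos]
        by (intro rotation_discrepancy_le_of_gaps) auto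
      also have "12 * \<psi> (N j) / h \<le> \<eta> / 2 * (real (N j) * l j)"
        using elim(3) h_bounds \<eta>_pos \<psi>_pos[of "N j"] by (simp add: field_simps)
      also have "h * real (N j) * l j \<le> \<eta> / 2 * (real (N j) * l j)"
        using mult_right_mono[OF h_bounds(3), of "real (N j) * l j"] l_pos[of j]
        by (simp add: mult.assoc)
      finally show "rotation_discrepancy \<beta> (l j) w m M \<le> \<eta> * (real (N j) * l j)"
        by (simp add: mult_ac)
    qed
  qed
qed

section \<open>Almost every number has Khinchin type\<close>

lemma AE_lborel_mult:
  assumes c_nonzero: "c \<noteq> 0" and ae: "AE x in lborel. P (x :: real)"
  shows "AE x in lborel. P (c * x)"
proof (rule AE_distrD[where f = "(*) c" and M' = borel])
  show "AE x in distr lborel borel ((*) c). P x"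
    using ae unfolding lborel_distr_mult[OF c_nonzero] by (intro AE_density[THEN iffD2]) auto
qed simp

definition near_rationals :: "nat \<Rightarrow> nat \<Rightarrow> real \<Rightarrow> real set" where
  "near_rationals R q \<delta> = {\<alpha>\<in>{- real R..real R}. \<exists>p::int. \<bar>real q * \<alpha> - of_int p\<bar> < \<delta>}"

lemma sets_near_rationals [measurable]: "near_rationals R q \<delta> \<in> sets lborel"
proof -
  have "near_rationals R q \<delta>
      = {\<alpha>\<in>space lborel. \<bar>\<alpha>\<bar> \<le> real R \<and> (\<exists>p::int. \<bar>real q * \<alpha> - of_int p\<bar> < \<delta>)}"
    by (auto simp: near_rationals_def)
  also have "\<dots> \<in> sets lborel" by measurable
  finally show ?thesis .
qed

lemma measure_near_rationals_le:
  assumes q_pos: "q > 0" and \<delta>_bounds: "0 \<le> \<delta>" "\<delta> \<le> 1"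
  shows "measure lborel (near_rationals R q \<delta>) \<le> (4 * real R + 6) * \<delta>"
proof -
  define P where "P = {- int (q * R + 1)..int (q * R + 1)}"
  let ?I = "\<lambda>p::int. {(of_int p - \<delta>) / real q .. (of_int p + \<delta>) / real q}"
  have "near_rationals R q \<delta> \<subseteq> (\<Union>p\<in>P. ?I p)"
  proof
    fix \<alpha> assume "\<alpha> \<in> near_rationals R q \<delta>"
    then obtain p :: int where \<alpha>_bound: "\<bar>\<alpha>\<bar> \<le> real R" and p_near: "\<bar>real q * \<alpha> - of_int p\<bar> < \<delta>"
      by (auto simp: near_rationals_def)
    have "\<bar>real q * \<alpha>\<bar> \<le> real q * real R" using \<alpha>_bound by (simp add: abs_mult mult_left_mono)
    then have "of_int \<bar>p\<bar> \<le> real_of_int (int (q * R + 1))" using p_near \<delta>_bounds(2) by simp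
    then have "p \<in> P" unfolding P_def of_int_le_iff by auto
    moreover have "\<alpha> \<in> ?I p" using p_near q_pos by (auto simp: field_simps abs_less_iff)
    ultimately show "\<alpha> \<in> (\<Union>p\<in>P. ?I p)" by blast
  qed
  moreover have "(\<Union>p\<in>P. ?I p) \<in> fmeasurable lborel"
    unfolding P_def by (intro fmeasurable.finite_UN fmeasurable_compact) auto
  ultimately have "measure lborel (near_rationals R q \<delta>) \<le> measure lborel (\<Union>p\<in>P. ?I p)"
    by (intro measure_mono_fmeasurable sets_near_rationals)
  also have "\<dots> \<le> (\<Sum>p\<in>P. measure lborel (?I p))" by (rule measure_UNION_le) (auto simp: P_def)
  also have "\<dots> = (\<Sum>p\<in>P. 2 * \<delta> / real q)"
    using q_pos \<delta>_bounds
    by (intro sum.cong refl) (simp add: divide_right_mono flip: diff_divide_distrib)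
  also have "\<dots> = (4 * real R + 6 / real q) * \<delta>" using q_pos by (simp add: P_def field_simps)
  also have "\<dots> \<le> (4 * real R + 6) * \<delta>"
    using q_pos \<delta>_bounds by (intro mult_right_mono add_left_mono) (auto simp: field_simps)
  finally show ?thesis .
qed

lemma AE_khinchin_type:
  fixes \<psi> :: "nat \<Rightarrow> real"
  assumes \<psi>_ge_1: "\<And>q. 1 \<le> \<psi> q" and summable: "summable (\<lambda>q. 1 / (real q * \<psi> q))"
  shows "AE \<alpha> in lborel. khinchin_type \<psi> \<alpha>"
proof -
  define \<delta> where "\<delta> = (\<lambda>q. 1 / (real q * \<psi> q))"
  have \<delta>_bounds: "0 \<le> \<delta> q" "\<delta> q \<le> 1" if "q > 0" for q
    using \<psi>_ge_1[of q] mult_mono[of 1 "real q" 1 "\<psi> q"] that by (auto simp: \<delta>_def)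
  have "AE \<alpha> in lborel. \<forall>\<^sub>F q in sequentially. \<alpha> \<in> space lborel - near_rationals R q (\<delta> q)" for R
  proof (rule borel_cantelli_AE1)
    have "bounded (near_rationals R q (\<delta> q))" for q
      by (rule bounded_subset[of "{- real R..real R}"]) (auto simp: near_rationals_def)
    then show "emeasure lborel (near_rationals R q (\<delta> q)) < \<infinity>" for q
      by (rule emeasure_bounded_finite)
    show "summable (\<lambda>q. measure lborel (near_rationals R q (\<delta> q)))"
    proof (rule summable_comparison_test'[where N = 1])
      show "summable (\<lambda>q. (4 * real R + 6) * \<delta> q)"
        using summable unfolding \<delta>_def by (rule summable_mult)
      show "norm (measure lborel (near_rationals R q (\<delta> q))) \<le> (4 * real R + 6) * \<delta> q"
        if "q \<ge> 1" for q
        using measure_near_rationals_le[of q "\<delta> q" R] \<delta>_bounds[of q] that by simp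
    qed
  qed measurable
  then have "AE \<alpha> in lborel. \<forall>R. \<forall>\<^sub>F q in sequentially. \<alpha> \<notin> near_rationals R q (\<delta> q)"
    unfolding AE_all_countable by simp
  then show ?thesis
  proof eventually_elim
    case (elim \<alpha>)
    define R where "R = nat \<lceil>\<bar>\<alpha>\<bar>\<rceil>"
    have "\<alpha> \<in> {- real R..real R}" unfolding R_def atLeastAtMost_iff by linarith
    moreover have "\<forall>\<^sub>F q in sequentially. \<alpha> \<notin> near_rationals R q (\<delta> q)" using elim by blast
    ultimately show ?case
      unfolding khinchin_type_def
      by (auto elim!: eventually_mono simp: near_rationals_def \<delta>_def not_less)
  qed
qed

section \<open>The logarithmic weights\<close>

text \<open>The shift by \<open>exp (exp 1)\<close> makes both logarithms at least \<open>1\<close> on the nonnegative reals.\<close>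

definition loglog_weight :: "real \<Rightarrow> real \<Rightarrow> real" where
  "loglog_weight e t = ln (t + exp (exp 1)) * ln (ln (t + exp (exp 1))) powr e"

lemma ln_shift_ge:
  assumes "0 \<le> t"
  shows "1 \<le> ln (t + exp (exp 1 :: real))" "1 \<le> ln (ln (t + exp (exp 1 :: real)))"
proof -
  have "ln (exp (exp (1 :: real))) \<le> ln (t + exp (exp 1))"
    using assms by (intro ln_mono) auto
  then have ln_ge_exp: "exp 1 \<le> ln (t + exp (exp 1 :: real))" by simp
  then have "ln (exp (1 :: real)) \<le> ln (ln (t + exp (exp 1)))"
    by (intro ln_mono) auto
  then show "1 \<le> ln (ln (t + exp (exp 1 :: real)))" by simp
  show "1 \<le> ln (t + exp (exp 1 :: real))" using ln_ge_exp one_le_exp_iff[of "1 :: real"] by linarith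
qed

lemma loglog_weight_ge_1:
  assumes "0 \<le> e" "0 \<le> t"
  shows "1 \<le> loglog_weight e t"
proof -
  have "1 * 1 \<le> loglog_weight e t"
    unfolding loglog_weight_def using ln_shift_ge[OF assms(2)] assms(1)
    by (intro mult_mono ge_one_powr_ge_zero) auto
  then show ?thesis by simp
qed

lemma loglog_weight_mono:
  assumes "0 \<le> e" "0 \<le> s" "s \<le> t"
  shows "loglog_weight e s \<le> loglog_weight e t"
proof -
  have ln_le: "ln (s + exp (exp 1)) \<le> ln (t + exp (exp 1))"
    using assms by (intro ln_mono) (auto intro: add_nonneg_pos)
  moreover have "ln (ln (s + exp (exp 1))) \<le> ln (ln (t + exp (exp 1)))"
    by (rule ln_mono[OF ln_le]) (use ln_shift_ge(1)[OF assms(2)] in linarith)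
  ultimately show ?thesis
    unfolding loglog_weight_def using assms(1) ln_shift_ge[OF assms(2)]
    by (intro mult_mono powr_mono2) auto
qed

lemma mono_loglog_weight: "0 \<le> e \<Longrightarrow> mono (\<lambda>q::nat. loglog_weight e (real q))"
  by (intro monoI loglog_weight_mono) auto

lemma has_real_derivative_lnln_powr:
  assumes \<epsilon>_pos: "\<epsilon> > 0" and t_nonneg: "0 \<le> t"
  shows "((\<lambda>t. - (ln (ln (t + exp (exp 1))) powr - \<epsilon>) / \<epsilon>) has_real_derivative
    1 / ((t + exp (exp 1)) * loglog_weight (1 + \<epsilon>) t)) (at t)"
proof -
  let ?E = "exp (exp 1) :: real"
  have pos: "0 < t + ?E" "0 < ln (t + ?E)" "0 < ln (ln (t + ?E))"
    using t_nonneg ln_shift_ge[OF t_nonneg] exp_gt_zero[of "exp 1"] by linarith+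
  have "- \<epsilon> - 1 = - (1 + \<epsilon>)" by simp
  then have "ln (ln (t + ?E)) powr (- \<epsilon> - 1) = 1 / ln (ln (t + ?E)) powr (1 + \<epsilon>)"
    by (simp only: powr_minus_divide)
  with pos \<epsilon>_pos show ?thesis
    unfolding loglog_weight_def by (auto intro!: derivative_eq_intros simp: divide_simps)
qed

lemma summable_inverse_loglog_weight:
  assumes \<epsilon>_pos: "\<epsilon> > 0"
  shows "summable (\<lambda>q. 1 / (real q * loglog_weight (1 + \<epsilon>) (real q)))"
proof -
  define E where "E = exp (exp (1 :: real))"
  have E_pos: "0 < E" by (simp add: E_def)
  define h where "h = (\<lambda>t. 1 / ((t + E) * loglog_weight (1 + \<epsilon>) t))"
  define F where "F = (\<lambda>t. - (ln (ln (t + E)) powr - \<epsilon>) / \<epsilon>)"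
  have weight_pos: "0 < loglog_weight (1 + \<epsilon>) t" if "0 \<le> t" for t
    using loglog_weight_ge_1[of "1 + \<epsilon>" t] \<epsilon>_pos that by simp
  have deriv: "(F has_real_derivative h t) (at t)" if "0 \<le> t" for t
    using has_real_derivative_lnln_powr[OF \<epsilon>_pos that] by (simp add: F_def h_def E_def)
  interpret antimono_fun_sum_integral_diff h
  proof
    fix s t :: real assume "0 \<le> s" "s \<le> t"
    then show "h t \<le> h s"
      unfolding h_def using weight_pos[of s] weight_pos[of t] E_pos \<epsilon>_pos
      by (intro divide_left_mono mult_mono loglog_weight_mono mult_pos_pos) auto
  next
    fix t :: real assume "0 \<le> t"
    then show "0 \<le> h t" using weight_pos[of t] E_pos by (simp add: h_def)
  next
    have "t + E \<noteq> 0" "ln (t + E) \<noteq> 0" "ln (ln (t + E)) \<noteq> 0" if "t \<in> {0..}" for t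
      using ln_shift_ge[of t] that E_pos by (auto simp: E_def)
    then show "continuous_on {0..} h"
      unfolding h_def loglog_weight_def by (intro continuous_intros) (auto simp: E_def)
  qed
  have "integral {0..real n} h = F (real n) - F 0" for n
    by (intro integral_unique fundamental_theorem_of_calculus)
      (auto intro: DERIV_subset[OF deriv] simp flip: has_real_derivative_iff_has_vector_derivative)
  moreover have "(\<lambda>n. F (real n) - F 0) \<longlonglongrightarrow> 0 - F 0"
    unfolding F_def E_def using \<epsilon>_pos by (intro tendsto_diff tendsto_const) real_asymp
  ultimately have "summable (\<lambda>n. norm (h (real n)))"
    using integral_test by (simp add: nonneg convergent_def) blast
  moreover have "(\<lambda>q. 1 / (real q * loglog_weight (1 + \<epsilon>) (real q))) \<in> O(\<lambda>q. h (real q))"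
    unfolding h_def loglog_weight_def E_def using \<epsilon>_pos by real_asymp
  ultimately show ?thesis by (rule summable_comparison_test_bigo)
qed

text \<open>The exponent lies strictly between the one of the Khinchin weight, \<open>1 + c / 3\<close>, and the one of
  \<open>gammaN\<close>, \<open>1 + c\<close>; both gaps are needed.\<close>

definition perturb_scale :: "real \<Rightarrow> nat \<Rightarrow> real" where
  "perturb_scale c j = min 1 (loglog_weight (1 + 2 * c / 3) (2 ^ j) / 2 ^ j)"

lemma perturb_scale_le_1: "perturb_scale c j \<le> 1"
  unfolding perturb_scale_def by (rule min.cobounded1)

lemma perturb_scale_pos: "c > 0 \<Longrightarrow> 0 < perturb_scale c j"
  using loglog_weight_ge_1[of "1 + 2 * c / 3" "2 ^ j"] by (simp add: perturb_scale_def)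

lemma tendsto_loglog_weight_over: "((\<lambda>t. loglog_weight e t / t) \<longlongrightarrow> 0) at_top"
  unfolding loglog_weight_def by real_asymp

lemma filterlim_two_power: "filterlim (\<lambda>j::nat. (2 :: real) ^ j) at_top sequentially"
  by real_asymp

lemma eventually_perturb_scale_eq:
  "\<forall>\<^sub>F j in sequentially. perturb_scale c j = loglog_weight (1 + 2 * c / 3) (2 ^ j) / 2 ^ j"
proof -
  have "(\<lambda>j::nat. loglog_weight (1 + 2 * c / 3) (2 ^ j) / 2 ^ j) \<longlonglongrightarrow> 0"
    by (rule filterlim_compose[OF tendsto_loglog_weight_over filterlim_two_power])
  then have "\<forall>\<^sub>F j::nat in sequentially. loglog_weight (1 + 2 * c / 3) (2 ^ j) / 2 ^ j < 1"
    by (rule order_tendstoD) simp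
  then show ?thesis by eventually_elim (simp add: perturb_scale_def)
qed

lemma tendsto_perturb_scale: "perturb_scale c \<longlonglongrightarrow> 0"
  using filterlim_compose[OF tendsto_loglog_weight_over filterlim_two_power]
  by (subst filterlim_cong[OF refl refl eventually_perturb_scale_eq])

lemma filterlim_perturb_scale_over_weight:
  assumes "c > 0"
  shows "filterlim (\<lambda>j. 2 ^ j * perturb_scale c j / loglog_weight (1 + c / 3) (2 ^ j))
      at_top sequentially"
proof -
  have "filterlim (\<lambda>t. loglog_weight (1 + 2 * c / 3) t / loglog_weight (1 + c / 3) t) at_top at_top"
    unfolding loglog_weight_def using assms by real_asymp
  then have "filterlim
      (\<lambda>j::nat. loglog_weight (1 + 2 * c / 3) (2 ^ j) / loglog_weight (1 + c / 3) (2 ^ j))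
      at_top sequentially"
    by (rule filterlim_compose[OF _ filterlim_two_power])
  moreover have "\<forall>\<^sub>F j in sequentially.
      loglog_weight (1 + 2 * c / 3) (2 ^ j) / loglog_weight (1 + c / 3) (2 ^ j)
      = 2 ^ j * perturb_scale c j / loglog_weight (1 + c / 3) (2 ^ j)"
    using eventually_perturb_scale_eq[of c] by eventually_elim simp
  ultimately show ?thesis by (simp cong: filterlim_cong)
qed

lemma eventually_perturb_scale_less_gammaN:
  assumes c_pos: "c > 0"
  shows "\<forall>\<^sub>F N in sequentially. 2 * perturb_scale c (floor_log N - 1) < gammaN c N"
proof -
  have "\<forall>\<^sub>F N in sequentially. 8 * loglog_weight (1 + 2 * c / 3) (real N) / real N < gammaN c N"
    unfolding loglog_weight_def gammaN_def using c_pos by real_asymp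
  then show ?thesis using eventually_ge_at_top[of 2]
  proof eventually_elim
    case (elim N)
    let ?W = "loglog_weight (1 + 2 * c / 3)" and ?t = "2 ^ (floor_log N - 1) :: real"
    have "1 \<le> floor_log N" using floor_log_rec[OF elim(2)] by simp
    then have "(2::nat) ^ floor_log N = 2 * 2 ^ (floor_log N - 1)" by (simp flip: power_Suc)
    moreover have "2 ^ floor_log N \<le> N" "N < 2 * 2 ^ floor_log N"
      using floor_log_exp2_le[of N] floor_log_exp2_gt[of N] elim(2) by auto
    ultimately have "real (2 * 2 ^ (floor_log N - 1)) \<le> real N"
      "real N < real (4 * 2 ^ (floor_log N - 1))"
      by (simp_all only: of_nat_le_iff of_nat_less_iff)
    then have "2 * ?t \<le> real N" "real N < 4 * ?t" by simp_all
    moreover have "0 < ?t" by simp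
    ultimately have t_bounds: "?t \<le> real N" "real N / 4 \<le> ?t" by linarith+
    have "2 * perturb_scale c (floor_log N - 1) \<le> 2 * (?W ?t / ?t)" by (simp add: perturb_scale_def)
    also have "\<dots> \<le> 2 * (?W (real N) / (real N / 4))"
      using t_bounds elim(2) c_pos loglog_weight_ge_1[of "1 + 2 * c / 3" "real N"]
      by (intro mult_left_mono frac_le loglog_weight_mono) auto
    also have "\<dots> < gammaN c N" using elim(1) by simp
    finally show ?case .
  qed
qed

section \<open>Randomly perturbed points in short arcs\<close>

abbreviation unif :: "real measure" where
  "unif \<equiv> uniform_measure lborel {0..1}"

lemma prob_space_unif: "prob_space unif"
  by (rule prob_space_uniform_measure) auto

lemma measure_unif:
  assumes "S \<in> sets lborel"
  shows "measure unif S = measure lborel ({0..1} \<inter> S)"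
  using assms by (simp add: measure_def emeasure_uniform_measure divide_ennreal_def)

definition arc_prob :: "real \<Rightarrow> real \<Rightarrow> real \<Rightarrow> real \<Rightarrow> real" where
  "arc_prob v \<kappa> lo hi = measure unif {u. in_mod1 (v - \<kappa> * u) lo hi}"

lemma arc_prob_nonneg: "0 \<le> arc_prob v \<kappa> lo hi"
  by (simp add: arc_prob_def)

lemma sets_in_mod1_diff [measurable]: "{t\<in>{a..b}. in_mod1 (v - t) lo hi} \<in> sets lborel"
  by measurable

lemma arc_prob_eq_Icc:
  assumes \<kappa>_pos: "0 < \<kappa>"
  shows "arc_prob v \<kappa> lo hi = measure lborel {t\<in>{0..\<kappa>}. in_mod1 (v - t) lo hi} / \<kappa>"
proof -
  let ?S = "{u. in_mod1 (v - \<kappa> * u) lo hi}" and ?T = "{t\<in>{0..\<kappa>}. in_mod1 (v - t) lo hi}"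
  have "?S = {u \<in> space lborel. in_mod1 (v - \<kappa> * u) lo hi}" by simp
  also have "\<dots> \<in> sets lborel" by measurable
  finally have "arc_prob v \<kappa> lo hi = measure lborel ({0..1} \<inter> ?S)"
    unfolding arc_prob_def by (rule measure_unif)
  also have "\<dots> = (\<integral>u. indicator ({0..1} \<inter> ?S) u \<partial>lborel)" by simp
  also have "\<dots> = (\<integral>u. indicator ?T (0 + \<kappa> * u) \<partial>lborel)"
    using \<kappa>_pos by (intro Bochner_Integration.integral_cong refl)
      (auto simp: indicator_def zero_le_mult_iff mult_le_cancel_left1)
  also have "\<dots> = (\<integral>t. indicator ?T t \<partial>lborel) / \<kappa>"
    using \<kappa>_pos lborel_integral_real_affine[of \<kappa> "indicator ?T :: real \<Rightarrow> real" 0] by simp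
  finally show ?thesis by simp
qed

lemma in_mod1_diff_iff_floor:
  assumes "(b - a) + (d - c) < 1" and "t \<in> {a..b}"
  shows "in_mod1 (v - t) c d \<longleftrightarrow> c \<le> v - t - of_int \<lfloor>v - (a + c)\<rfloor> \<and> v - t - of_int \<lfloor>v - (a + c)\<rfloor> \<le> d"
proof
  assume "in_mod1 (v - t) c d"
  then obtain m :: int where m_bounds: "c \<le> v - t - of_int m" "v - t - of_int m \<le> d"
    unfolding in_mod1_def by blast
  with assms have "\<lfloor>v - (a + c)\<rfloor> = m" by (intro floor_unique) auto
  with m_bounds show "c \<le> v - t - of_int \<lfloor>v - (a + c)\<rfloor> \<and> v - t - of_int \<lfloor>v - (a + c)\<rfloor> \<le> d" by simp
next
  assume "c \<le> v - t - of_int \<lfloor>v - (a + c)\<rfloor> \<and> v - t - of_int \<lfloor>v - (a + c)\<rfloor> \<le> d"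
  then show "in_mod1 (v - t) c d" unfolding in_mod1_def by blast
qed

text \<open>Exchanges the roles of the two arcs: the short target becomes the domain of integration,
  and the points of a rotation only have to be counted in the longer arc.\<close>

lemma measure_in_mod1_swap:
  assumes short: "(b - a) + (d - c) < 1"
  shows "measure lborel {t\<in>{a..b}. in_mod1 (v - t) c d}
      = measure lborel {z\<in>{c..d}. in_mod1 (v - z) a b}"
proof -
  define w where "w = v - of_int \<lfloor>v - (a + c)\<rfloor>"
  have "{t\<in>{a..b}. in_mod1 (v - t) c d} = {max a (w - d)..min b (w - c)}"
    using in_mod1_diff_iff_floor[OF short] by (auto simp: w_def)
  moreover have "{z\<in>{c..d}. in_mod1 (v - z) a b} = {max c (w - b)..min d (w - a)}"
    using in_mod1_diff_iff_floor[of d c b a] short by (auto simp: w_def add.commute[of c a])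
  moreover have "min b (w - c) - max a (w - d) = min d (w - a) - max c (w - b)"
    by (simp add: min_def max_def)
  ultimately show ?thesis by (simp add: measure_def emeasure_lborel_Icc_eq)
qed

lemma measure_in_mod1_le:
  assumes "a \<le> b" "lo \<le> hi"
  shows "measure lborel {t\<in>{a..b}. in_mod1 (v - t) lo hi} \<le> (b - a + (hi - lo) + 1) * (hi - lo)"
proof -
  let ?S = "{\<lceil>v - b - hi\<rceil>..\<lfloor>v - a - lo\<rfloor>}"
  let ?I = "\<lambda>m::int. {v - of_int m - hi .. v - of_int m - lo}"
  have "{t\<in>{a..b}. in_mod1 (v - t) lo hi} \<subseteq> (\<Union>m\<in>?S. ?I m)"
  proof
    fix t assume "t \<in> {t\<in>{a..b}. in_mod1 (v - t) lo hi}"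
    then obtain m :: int where m_bounds: "t \<in> {a..b}" "lo \<le> v - t - of_int m"
      "v - t - of_int m \<le> hi"
      unfolding in_mod1_def by auto
    then have "m \<in> ?S" unfolding atLeastAtMost_iff ceiling_le_iff le_floor_iff by auto
    moreover have "t \<in> ?I m" using m_bounds by auto
    ultimately show "t \<in> (\<Union>m\<in>?S. ?I m)" by blast
  qed
  moreover have "(\<Union>m\<in>?S. ?I m) \<in> fmeasurable lborel"
    by (intro fmeasurable.finite_UN fmeasurable_compact) auto
  ultimately have "measure lborel {t\<in>{a..b}. in_mod1 (v - t) lo hi} \<le> measure lborel (\<Union>m\<in>?S. ?I m)"
    by (intro measure_mono_fmeasurable sets_in_mod1_diff)
  also have "\<dots> \<le> (\<Sum>m\<in>?S. measure lborel (?I m))" by (rule measure_UNION_le) auto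
  also have "\<dots> = real (card ?S) * (hi - lo)" using assms by simp
  also have "\<dots> \<le> ((v - a - lo) - (v - b - hi) + 1) * (hi - lo)"
    using assms by (intro mult_right_mono card_int_interval_bounds(2)) auto
  finally show ?thesis by (simp add: algebra_simps)
qed

lemma arc_prob_le:
  assumes \<kappa>_pos: "0 < \<kappa>" and lo_le_hi: "lo \<le> hi" and short: "hi - lo \<le> 1"
  shows "arc_prob v \<kappa> lo hi \<le> (1 + 2 / \<kappa>) * (hi - lo)"
proof -
  have "arc_prob v \<kappa> lo hi \<le> (\<kappa> - 0 + (hi - lo) + 1) * (hi - lo) / \<kappa>"
    unfolding arc_prob_eq_Icc[OF \<kappa>_pos]
    using \<kappa>_pos lo_le_hi by (intro divide_right_mono measure_in_mod1_le) auto
  also have "\<dots> \<le> (\<kappa> + 2) * (hi - lo) / \<kappa>"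
    using \<kappa>_pos lo_le_hi short by (intro divide_right_mono mult_right_mono) auto
  also have "\<dots> = (1 + 2 / \<kappa>) * (hi - lo)" using \<kappa>_pos by (simp add: field_simps)
  finally show ?thesis .
qed

lemma sum_measure_bounds:
  fixes c :: real
  assumes S_fmeasurable: "S \<in> fmeasurable M"
    and A_sets: "\<And>b. b \<in> B \<Longrightarrow> A b \<in> sets M" and A_subset: "\<And>b. b \<in> B \<Longrightarrow> A b \<subseteq> S"
  shows "(\<And>z. z \<in> S \<Longrightarrow> c \<le> (\<Sum>b\<in>B. indicator (A b) z)) \<Longrightarrow>
      c * measure M S \<le> (\<Sum>b\<in>B. measure M (A b))"
    and "(\<And>z. z \<in> S \<Longrightarrow> (\<Sum>b\<in>B. indicator (A b) z) \<le> c) \<Longrightarrow>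
      (\<Sum>b\<in>B. measure M (A b)) \<le> c * measure M S"
proof -
  have A_fm: "A b \<in> fmeasurable M" if "b \<in> B" for b
    using A_sets[OF that] A_subset[OF that] S_fmeasurable by (auto intro: fmeasurableI2)
  have integrable_sum: "integrable M (\<lambda>z. \<Sum>b\<in>B. indicator (A b) z :: real)"
    using A_fm by (auto simp: fmeasurable_def)
  have integrable_const: "integrable M (\<lambda>z. c * indicator S z)"
    using S_fmeasurable by (auto simp: fmeasurable_def)
  have outside: "(\<Sum>b\<in>B. indicator (A b) z) = (0 :: real)" if "z \<notin> S" for z
    using that A_subset by (intro sum.neutral) (auto simp: indicator_def)
  have sum_eq: "(\<Sum>b\<in>B. measure M (A b)) = (\<integral>z. (\<Sum>b\<in>B. indicator (A b) z) \<partial>M)"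
    using A_fm sets.sets_into_space[OF A_sets]
    by (subst Bochner_Integration.integral_sum) (auto simp: fmeasurable_def Int_absorb2)
  have integral_const: "c * measure M S = (\<integral>z. c * indicator S z \<partial>M)"
    using fmeasurableD[OF S_fmeasurable, THEN sets.sets_into_space] by (simp add: Int_absorb2)
  show "c * measure M S \<le> (\<Sum>b\<in>B. measure M (A b))"
    if "\<And>z. z \<in> S \<Longrightarrow> c \<le> (\<Sum>b\<in>B. indicator (A b) z)"
    unfolding sum_eq integral_const using that outside
    by (intro integral_mono integrable_sum integrable_const) (auto simp: indicator_def[of S])
  show "(\<Sum>b\<in>B. measure M (A b)) \<le> c * measure M S"
    if "\<And>z. z \<in> S \<Longrightarrow> (\<Sum>b\<in>B. indicator (A b) z) \<le> c"
    unfolding sum_eq integral_const using that outside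
    by (intro integral_mono integrable_sum integrable_const) (auto simp: indicator_def[of S])
qed

lemma sum_arc_prob_bound:
  assumes \<kappa>_pos: "0 < \<kappa>" and lo_le_hi: "lo \<le> hi" and short: "\<kappa> + (hi - lo) < 1"
    and finite_B: "finite B"
    and count: "\<And>w. \<bar>real (arc_count (\<lambda>b. w - \<beta> * real b) B 0 \<kappa>) - A * \<kappa>\<bar> \<le> e * \<kappa>"
  shows "\<bar>(\<Sum>b\<in>B. arc_prob (y - \<beta> * real b) \<kappa> lo hi) - A * (hi - lo)\<bar> \<le> e * (hi - lo)"
proof -
  let ?S = "\<lambda>b. {z\<in>{lo..hi}. in_mod1 (y - \<beta> * real b - z) 0 \<kappa>}"
  have arc_prob_eq: "arc_prob (y - \<beta> * real b) \<kappa> lo hi = measure lborel (?S b) / \<kappa>" for b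
    using measure_in_mod1_swap[of \<kappa> 0 hi lo] short by (simp add: arc_prob_eq_Icc[OF \<kappa>_pos])
  have sum_indicator: "(\<Sum>b\<in>B. indicator (?S b) z)
      = real (arc_count (\<lambda>b. (y - z) - \<beta> * real b) B 0 \<kappa>)" if "z \<in> {lo..hi}" for z
    using that by (simp add: arc_count_eq_sum[OF finite_B] indicator_def of_bool_def algebra_simps)
  have near: "(A - e) * \<kappa> \<le> real (arc_count (\<lambda>b. w - \<beta> * real b) B 0 \<kappa>)"
    "real (arc_count (\<lambda>b. w - \<beta> * real b) B 0 \<kappa>) \<le> (A + e) * \<kappa>" for w
    using count[of w] by (auto simp: abs_le_iff algebra_simps)
  have "{lo..hi} \<in> fmeasurable lborel" "?S b \<subseteq> {lo..hi}" for b by (auto intro: fmeasurable_compact)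
  note bounds = sum_measure_bounds[OF this(1) sets_in_mod1_diff this(2)]
  have "(A - e) * \<kappa> * measure lborel {lo..hi} \<le> (\<Sum>b\<in>B. measure lborel (?S b))"
    by (rule bounds(1)) (simp only: sum_indicator near)
  moreover have "(\<Sum>b\<in>B. measure lborel (?S b)) \<le> (A + e) * \<kappa> * measure lborel {lo..hi}"
    by (rule bounds(2)) (simp only: sum_indicator near)
  ultimately have "(A - e) * (hi - lo) \<le> (\<Sum>b\<in>B. measure lborel (?S b)) / \<kappa>"
    "(\<Sum>b\<in>B. measure lborel (?S b)) / \<kappa> \<le> (A + e) * (hi - lo)"
    using \<kappa>_pos lo_le_hi by (auto simp: pos_le_divide_eq pos_divide_le_eq mult_ac)
  then show ?thesis
    unfolding arc_prob_eq by (simp add: abs_le_iff algebra_simps flip: sum_divide_distrib)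
qed

section \<open>Dyadic decomposition\<close>

lemma dyadic_sum_bound:
  fixes a :: "nat \<Rightarrow> real"
  assumes block: "\<And>j M. j \<ge> j0 \<Longrightarrow> M \<le> 2 ^ j \<Longrightarrow> \<bar>\<Sum>b\<in>{2 ^ j..<2 ^ j + M}. a b\<bar> \<le> \<eta> * 2 ^ j"
    and initial: "\<bar>\<Sum>b\<in>{1..<2 ^ j0}. a b\<bar> \<le> K" and N_ge: "N \<ge> 2 ^ j0" and \<eta>_nonneg: "\<eta> \<ge> 0"
  shows "\<bar>\<Sum>b\<in>{1..N}. a b\<bar> \<le> K + 2 * \<eta> * real N"
proof -
  have split: "(\<Sum>b\<in>{1..<2 ^ j + M}. a b)
      = (\<Sum>b\<in>{1..<2 ^ j}. a b) + (\<Sum>b\<in>{2 ^ j..<2 ^ j + M}. a b)" for j M :: nat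
    by (subst sum.atLeastLessThan_concat) auto
  have full: "\<bar>\<Sum>b\<in>{1..<2 ^ J}. a b\<bar> \<le> K + \<eta> * 2 ^ J" if "J \<ge> j0" for J
    using that
  proof (induction J rule: dec_induct)
    case base
    have "0 \<le> \<eta> * 2 ^ j0" using \<eta>_nonneg by simp
    then show ?case using initial by linarith
  next
    case (step J)
    have "{1..<2 ^ Suc J} = {1..<2 ^ J + 2 ^ J :: nat}" by (simp add: mult_2)
    then have "(\<Sum>b\<in>{1..<2 ^ Suc J}. a b)
        = (\<Sum>b\<in>{1..<2 ^ J}. a b) + (\<Sum>b\<in>{2 ^ J..<2 ^ J + 2 ^ J}. a b)"
      using split[of J "2 ^ J"] by (simp only:)
    moreover have "\<eta> * 2 ^ Suc J = \<eta> * 2 ^ J + \<eta> * 2 ^ J" by simp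
    ultimately show ?case using step.IH block[OF step.hyps(1), of "2 ^ J"] by linarith
  qed
  have N_pos: "N > 0" using N_ge by (metis gr0I le_zero_eq power_not_zero zero_neq_numeral)
  define J where "J = floor_log N"
  define M where "M = N + 1 - 2 ^ J"
  have J_bounds: "2 ^ J \<le> N" "N < 2 * 2 ^ J" "j0 \<le> J"
    using floor_log_exp2_le[OF N_pos] floor_log_exp2_gt[of N] floor_log_le_iff[OF N_ge]
    by (simp_all add: J_def)
  then have M_bound: "M \<le> 2 ^ J" "{1..N} = {1..<2 ^ J + M}" by (auto simp: M_def)
  have "\<bar>\<Sum>b\<in>{1..N}. a b\<bar> \<le> K + \<eta> * 2 ^ J + \<eta> * 2 ^ J"
    unfolding M_bound(2) split
    using full[OF J_bounds(3)] block[OF J_bounds(3) M_bound(1)] by linarith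
  also have "\<dots> = K + 2 * \<eta> * real (2 ^ J)" by simp
  also have "\<dots> \<le> K + 2 * \<eta> * real N"
    using J_bounds(1) \<eta>_nonneg by (intro add_left_mono mult_left_mono of_nat_mono) auto
  finally show ?thesis .
qed

lemma eventually_le_mult_floor_log:
  fixes g :: "nat \<Rightarrow> real"
  assumes g_pos: "\<And>j. 0 < g j" and large: "filterlim (\<lambda>j. 2 ^ j * g j) at_top sequentially"
  shows "\<forall>\<^sub>F N in sequentially. \<forall>b\<in>{1..N}. K \<le> real N * g (floor_log b)"
proof -
  obtain j0 where j0_bound: "\<And>j. j \<ge> j0 \<Longrightarrow> K \<le> 2 ^ j * g j"
    using large unfolding filterlim_at_top eventually_sequentially by blast
  have "\<forall>\<^sub>F N in sequentially. K \<le> real N * g (floor_log b)" for b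
  proof -
    have "filterlim (\<lambda>N. g (floor_log b) * real N) at_top sequentially"
      using g_pos
      by (intro filterlim_tendsto_pos_mult_at_top[OF tendsto_const _ filterlim_real_sequentially])
    then show ?thesis by (simp add: filterlim_at_top mult.commute)
  qed
  then have "\<forall>\<^sub>F N in sequentially. \<forall>b\<in>{..<2 ^ j0}. K \<le> real N * g (floor_log b)"
    by (intro eventually_ball_finite) auto
  then show ?thesis
  proof eventually_elim
    case (elim N)
    show ?case
    proof
      fix b assume b_mem: "b \<in> {1..N}"
      show "K \<le> real N * g (floor_log b)"
      proof (cases "b < 2 ^ j0")
        case False
        then have "K \<le> 2 ^ floor_log b * g (floor_log b)"
          using floor_log_le_iff[of "2 ^ j0" b] by (intro j0_bound) simp
        also have "2 ^ floor_log b \<le> N" using b_mem floor_log_exp2_le[of b] by auto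
        then have "real (2 ^ floor_log b) \<le> real N" by (rule of_nat_mono)
        then have "2 ^ floor_log b * g (floor_log b) \<le> real N * g (floor_log b)"
          using g_pos[of "floor_log b"] by simp
        finally show ?thesis .
      qed (use elim in auto)
    qed
  qed
qed

section \<open>Equidistribution of a perturbed rotation\<close>

definition perturbed_seq :: "(nat \<Rightarrow> real) \<Rightarrow> (nat \<Rightarrow> real) \<Rightarrow> nat \<Rightarrow> real" where
  "perturbed_seq G \<omega> n = 2 * real n + G (floor_log n) * \<omega> n"

locale khinchin_perturbation =
  fixes \<psi> :: "nat \<Rightarrow> real" and G :: "nat \<Rightarrow> real"
  assumes \<psi>_mono: "mono \<psi>" and \<psi>_ge_1: "\<And>q. 1 \<le> \<psi> q"
    and \<psi>_summable: "summable (\<lambda>q. 1 / (real q * \<psi> q))"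
    and G_pos: "\<And>j. 0 < G j" and G_lim: "G \<longlonglongrightarrow> 0"
    and G_large: "filterlim (\<lambda>j. 2 ^ j * G j / \<psi> (2 ^ j)) at_top sequentially"

locale perturbed_rotation = khinchin_perturbation +
  fixes \<alpha> :: real
  assumes \<alpha>_pos: "0 < \<alpha>" and \<alpha>_type: "khinchin_type \<psi> (2 * \<alpha>)"
begin

definition hit_prob :: "real \<Rightarrow> real \<Rightarrow> real \<Rightarrow> nat \<Rightarrow> real" where
  "hit_prob y lo hi b = arc_prob (y - 2 * \<alpha> * real b) (\<alpha> * G (floor_log b)) lo hi"

lemma hit_prob_nonneg: "0 \<le> hit_prob y lo hi b"
  unfolding hit_prob_def by (rule arc_prob_nonneg)

lemma hit_prob_le:
  assumes "lo \<le> hi" "hi - lo \<le> 1"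
  shows "hit_prob y lo hi b \<le> (1 + 2 / (\<alpha> * G (floor_log b))) * (hi - lo)"
  unfolding hit_prob_def using assms \<alpha>_pos G_pos by (intro arc_prob_le) auto

lemma \<alpha>G_lim: "(\<lambda>j. \<alpha> * G j) \<longlonglongrightarrow> 0"
  using tendsto_mult_left[OF G_lim, of \<alpha>] by simp

lemma eventually_sum_hit_prob_dyadic_block:
  assumes \<eta>_pos: "\<eta> > 0"
  shows "\<forall>\<^sub>F j in sequentially. \<forall>M\<le>2 ^ j. \<forall>y lo hi. lo \<le> hi \<longrightarrow> hi - lo \<le> 1/2 \<longrightarrow>
    \<bar>\<Sum>b\<in>{2 ^ j..<2 ^ j + M}. hit_prob y lo hi b - (hi - lo)\<bar> \<le> \<eta> * (hi - lo) * 2 ^ j"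
proof -
  have "\<forall>\<^sub>F j in sequentially. \<forall>m w M. M \<le> 2 ^ j \<longrightarrow>
     rotation_discrepancy (2 * \<alpha>) (\<alpha> * G j) w m M
        \<le> \<eta> * (real (2 ^ j) * (\<alpha> * G j))"
  proof (rule eventually_rotation_discrepancy_le[OF \<alpha>_type \<psi>_mono \<psi>_ge_1 _ \<alpha>G_lim])
    show "filterlim (\<lambda>j::nat. 2 ^ j :: nat) at_top sequentially"
      by (intro filterlim_subseq strict_monoI) simp
    have "filterlim (\<lambda>j. \<alpha> * (2 ^ j * G j / \<psi> (2 ^ j))) at_top sequentially"
      using \<alpha>_pos by (intro filterlim_tendsto_pos_mult_at_top[OF tendsto_const _ G_large])
    then show "filterlim (\<lambda>j. real (2 ^ j) * (\<alpha> * G j) / \<psi> (2 ^ j)) at_top sequentially"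
      by (simp add: mult_ac)
  qed (use \<alpha>_pos G_pos \<eta>_pos in auto)
  moreover have "\<forall>\<^sub>F j in sequentially. \<alpha> * G j < 1/2"
    using order_tendstoD(2)[OF \<alpha>G_lim, of "1/2"] by simp
  ultimately show ?thesis
  proof eventually_elim
    case (elim j)
    show ?case
    proof (intro allI impI)
      fix M :: nat and y lo hi :: real assume M_le: "M \<le> 2 ^ j" and arc_length: "lo \<le> hi"
        "hi - lo \<le> 1/2"
      have "floor_log b = j" if "b \<in> {2 ^ j..<2 ^ j + M}" for b
        using that M_le by (intro floor_log_eqI) auto
      then have "(\<Sum>b\<in>{2 ^ j..<2 ^ j + M}. hit_prob y lo hi b - (hi - lo)) =
          (\<Sum>b\<in>{2 ^ j..<2 ^ j + M}. arc_prob (y - 2 * \<alpha> * real b) (\<alpha> * G j) lo hi) - real M * (hi - lo)"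
        by (simp add: sum_subtractf hit_prob_def)
      moreover have "\<bar>\<dots>\<bar> \<le> \<eta> * 2 ^ j * (hi - lo)"
        using elim M_le arc_length \<alpha>_pos G_pos[of j]
        by (intro sum_arc_prob_bound) (auto simp: rotation_discrepancy_def mult.assoc)
      ultimately show "\<bar>\<Sum>b\<in>{2 ^ j..<2 ^ j + M}. hit_prob y lo hi b - (hi - lo)\<bar>
          \<le> \<eta> * (hi - lo) * 2 ^ j"
        by (simp add: mult_ac)
    qed
  qed
qed

lemma sum_hit_prob_deviation_le:
  assumes "lo \<le> hi" "hi - lo \<le> 1"
  shows "\<bar>\<Sum>b\<in>B. hit_prob y lo hi b - (hi - lo)\<bar> \<le> (\<Sum>b\<in>B. 2 + 2 / (\<alpha> * G (floor_log b))) * (hi - lo)"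
proof -
  have "\<bar>hit_prob y lo hi b - (hi - lo)\<bar> \<le> (2 + 2 / (\<alpha> * G (floor_log b))) * (hi - lo)" for b
    using hit_prob_le[OF assms, of y b] hit_prob_nonneg[of y lo hi b] assms
    by (simp add: algebra_simps)
  then show ?thesis
    unfolding sum_distrib_right by (intro order_trans[OF sum_abs] sum_mono)
qed

lemma eventually_sum_hit_prob:
  assumes \<eta>_pos: "\<eta> > 0"
  shows "\<forall>\<^sub>F N in sequentially. \<forall>y lo hi. lo \<le> hi \<longrightarrow> hi - lo \<le> 1/2 \<longrightarrow>
    \<bar>(\<Sum>b\<in>{1..N}. hit_prob y lo hi b) - real N * (hi - lo)\<bar> \<le> \<eta> * (real N * (hi - lo))"
proof -
  have "\<eta> / 3 > 0" using \<eta>_pos by simp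
  from eventually_sum_hit_prob_dyadic_block[OF this] obtain j0 where block:
    "\<And>j M y lo hi. j \<ge> j0 \<Longrightarrow> M \<le> 2 ^ j \<Longrightarrow> lo \<le> hi \<Longrightarrow> hi - lo \<le> 1/2 \<Longrightarrow>
     \<bar>\<Sum>b\<in>{2 ^ j..<2 ^ j + M}. hit_prob y lo hi b - (hi - lo)\<bar> \<le> \<eta> / 3 * (hi - lo) * 2 ^ j"
    unfolding eventually_sequentially by blast
  define K where "K = (\<Sum>b\<in>{1..<2 ^ j0}. 2 + 2 / (\<alpha> * G (floor_log b)))"
  have "filterlim (\<lambda>N. \<eta> / 3 * real N) at_top sequentially"
    using \<eta>_pos
    by (intro filterlim_tendsto_pos_mult_at_top[OF tendsto_const _ filterlim_real_sequentially]) auto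
  then have "\<forall>\<^sub>F N in sequentially. K \<le> \<eta> / 3 * real N" by (simp add: filterlim_at_top)
  then show ?thesis using eventually_ge_at_top[of "2 ^ j0"]
  proof eventually_elim
    case (elim N)
    show ?case
    proof (intro allI impI)
      fix y lo hi :: real assume lo_le_hi: "lo \<le> hi" and half: "hi - lo \<le> 1/2"
      have "\<bar>\<Sum>b\<in>{1..N}. hit_prob y lo hi b - (hi - lo)\<bar>
          \<le> K * (hi - lo) + 2 * (\<eta> / 3 * (hi - lo)) * real N"
        unfolding K_def
        using lo_le_hi half \<eta>_pos elim(2) sum_hit_prob_deviation_le[of lo hi y "{1..<2 ^ j0}"]
        by (intro dyadic_sum_bound block) auto
      moreover have "K * (hi - lo) \<le> \<eta> / 3 * real N * (hi - lo)"
        using elim(1) lo_le_hi by (intro mult_right_mono) auto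
      moreover have "(\<Sum>b\<in>{1..N}. hit_prob y lo hi b - (hi - lo))
          = (\<Sum>b\<in>{1..N}. hit_prob y lo hi b) - real N * (hi - lo)"
        by (simp add: sum_subtractf)
      moreover have "\<eta> / 3 * real N * (hi - lo) + 2 * (\<eta> / 3 * (hi - lo)) * real N
          = \<eta> * (real N * (hi - lo))"
        by (simp add: field_simps)
      ultimately show "\<bar>(\<Sum>b\<in>{1..N}. hit_prob y lo hi b) - real N * (hi - lo)\<bar>
          \<le> \<eta> * (real N * (hi - lo))"
        by linarith
    qed
  qed
qed

lemma eventually_hit_prob_small:
  assumes \<eta>_pos: "\<eta> > 0"
  shows "\<forall>\<^sub>F N in sequentially. \<forall>b\<in>{1..N}. \<forall>y lo hi. lo \<le> hi \<longrightarrow> hi - lo \<le> 1 \<longrightarrow>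
    hit_prob y lo hi b \<le> \<eta> * (real N * (hi - lo))"
proof -
  have "filterlim (\<lambda>j. 2 ^ j * G j) at_top sequentially"
  proof (rule filterlim_at_top_mono[OF G_large always_eventually], rule allI)
    show "2 ^ j * G j / \<psi> (2 ^ j) \<le> 2 ^ j * G j" for j
      using \<psi>_ge_1[of "2 ^ j"] G_pos[of j] by (simp add: pos_divide_le_eq)
  qed
  from eventually_le_mult_floor_log[OF G_pos this, of "4 / (\<eta> * \<alpha>)"]
  have "\<forall>\<^sub>F N in sequentially. \<forall>b\<in>{1..N}. 4 / (\<eta> * \<alpha>) \<le> real N * G (floor_log b)" .
  moreover have "\<forall>\<^sub>F N in sequentially. 2 / \<eta> \<le> real N"
    using filterlim_real_sequentially by (simp add: filterlim_at_top)
  ultimately show ?thesis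
  proof eventually_elim
    case (elim N)
    show ?case
    proof (intro ballI allI impI)
      fix b y and lo hi :: real assume b_mem: "b \<in> {1..N}" and arc_length: "lo \<le> hi" "hi - lo \<le> 1"
      have "2 / (\<alpha> * G (floor_log b)) \<le> \<eta> / 2 * real N"
        using elim(1) b_mem \<eta>_pos \<alpha>_pos G_pos[of "floor_log b"] by (simp add: field_simps)
      moreover have "1 \<le> \<eta> / 2 * real N" using elim(2) \<eta>_pos by (simp add: field_simps)
      ultimately have "1 + 2 / (\<alpha> * G (floor_log b)) \<le> \<eta> * real N" by linarith
      then have "(1 + 2 / (\<alpha> * G (floor_log b))) * (hi - lo) \<le> \<eta> * real N * (hi - lo)"
        using arc_length by (intro mult_right_mono) auto
      then show "hit_prob y lo hi b \<le> \<eta> * (real N * (hi - lo))"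
        using hit_prob_le[OF arc_length, of y b] by (simp add: mult.assoc)
    qed
  qed
qed

end

section \<open>Independent coordinates and variances\<close>

lemma (in product_prob_space) measure_PiM_resample:
  assumes i_mem: "i \<in> I" and A_sets [measurable]: "A \<in> sets (PiM I M)"
  shows "measure (PiM I M) A = (\<integral>\<omega>. measure (M i) {t \<in> space (M i). fun_upd \<omega> i t \<in> A} \<partial>PiM I M)"
    and "(\<lambda>\<omega>. measure (M i) {t \<in> space (M i). fun_upd \<omega> i t \<in> A}) \<in> borel_measurable (PiM I M)"
proof -
  interpret pair: pair_sigma_finite "M i" "PiM I M" ..
  let ?f = "\<lambda>(t, \<omega>). fun_upd \<omega> i t"
  have I_eq: "I = I \<union> {i}" using i_mem by blast
  have f_measurable: "?f \<in> measurable (M i \<Otimes>\<^sub>M PiM I M) (PiM I M)"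
    using measurable_fun_upd[OF I_eq, of snd "M i \<Otimes>\<^sub>M PiM I M" M fst]
    by (simp add: case_prod_beta)
  have distr_eq: "distr (M i \<Otimes>\<^sub>M PiM I M) (PiM I M) ?f = PiM I M"
    using distr_pair_PiM_eq_PiM[of I M i] prob_space by (simp add: insert_absorb[OF i_mem])
  let ?S = "?f -` A \<inter> space (M i \<Otimes>\<^sub>M PiM I M)"
  have S_sets: "?S \<in> sets (M i \<Otimes>\<^sub>M PiM I M)" by (rule measurable_sets[OF f_measurable A_sets])
  have slice: "(\<lambda>t. (t, \<omega>)) -` ?S = {t \<in> space (M i). fun_upd \<omega> i t \<in> A}"
    if "\<omega> \<in> space (PiM I M)" for \<omega>
    using that by (auto simp: space_pair_measure)
  have "emeasure (PiM I M) A = emeasure (M i \<Otimes>\<^sub>M PiM I M) ?S"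
    using emeasure_distr[OF f_measurable A_sets] by (simp only: distr_eq)
  also have "\<dots> = (\<integral>\<^sup>+\<omega>. emeasure (M i) ((\<lambda>t. (t, \<omega>)) -` ?S) \<partial>PiM I M)"
    by (rule pair.emeasure_pair_measure_alt2[OF S_sets])
  also have "\<dots> = (\<integral>\<^sup>+\<omega>. ennreal (measure (M i) {t \<in> space (M i). fun_upd \<omega> i t \<in> A}) \<partial>PiM I M)"
    by (intro nn_integral_cong) (simp only: slice M.emeasure_eq_measure)
  finally have emeasure_eq: "emeasure (PiM I M) A = \<dots>" .
  have "(\<lambda>\<omega>. enn2real (emeasure (M i) ((\<lambda>t. (t, \<omega>)) -` ?S))) \<in> borel_measurable (PiM I M)"
    using pair.measurable_emeasure_Pair2[OF S_sets] by measurable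
  then show slice_measurable: "(\<lambda>\<omega>. measure (M i) {t \<in> space (M i). fun_upd \<omega> i t \<in> A})
      \<in> borel_measurable (PiM I M)"
    by (rule measurable_cong[THEN iffD1, rotated]) (simp only: slice measure_def)
  show "measure (PiM I M) A = (\<integral>\<omega>. measure (M i) {t \<in> space (M i). fun_upd \<omega> i t \<in> A} \<partial>PiM I M)"
    unfolding measure_def[of "PiM I M"] emeasure_eq
    by (rule integral_eq_nn_integral[OF slice_measurable, symmetric]) simp
qed

definition (in product_prob_space) determined_by :: "'i set \<Rightarrow> ('i \<Rightarrow> 'a) set \<Rightarrow> bool" where
  "determined_by J A \<longleftrightarrow>
     (\<forall>\<omega>\<in>space (PiM I M). \<forall>\<omega>'\<in>space (PiM I M). (\<forall>j\<in>J. \<omega> j = \<omega>' j) \<longrightarrow> \<omega> \<in> A \<longrightarrow> \<omega>' \<in> A)"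

lemma (in product_prob_space) determined_by_imp_vimage_restrict:
  assumes A_sets: "A \<in> sets (PiM I M)" and determined: "determined_by J A" and J_subset: "J \<subseteq> I"
  shows "\<exists>A'\<in>sets (PiM J M). (\<lambda>\<omega>. restrict \<omega> J) -` A' \<inter> space (PiM I M) = A"
proof -
  obtain x0 where x0_space: "x0 \<in> space (PiM I M)" using P.not_empty by blast
  define e where "e = (\<lambda>\<omega>. merge J (I - J) (\<omega>, restrict x0 (I - J)))"
  have x0_rest: "restrict x0 (I - J) \<in> space (PiM (I - J) M)"
    using x0_space by (auto simp: space_PiM PiE_iff)
  have "J \<union> (I - J) = I" using J_subset by blast
  then have e_measurable: "e \<in> measurable (PiM J M) (PiM I M)"
    unfolding e_def
    using measurable_compose[OF measurable_Pair2'[OF x0_rest] measurable_merge, of J] by simp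
  define A' where "A' = e -` A \<inter> space (PiM J M)"
  have "restrict \<omega> J \<in> A' \<longleftrightarrow> \<omega> \<in> A" if \<omega>_space: "\<omega> \<in> space (PiM I M)" for \<omega>
  proof -
    have restrict_space: "restrict \<omega> J \<in> space (PiM J M)"
      using \<omega>_space J_subset by (auto simp: space_PiM PiE_iff)
    then have "e (restrict \<omega> J) \<in> space (PiM I M)" by (rule measurable_space[OF e_measurable])
    moreover have "e (restrict \<omega> J) j = \<omega> j" if "j \<in> J" for j
      using that by (simp add: e_def merge_def)
    ultimately have "e (restrict \<omega> J) \<in> A \<longleftrightarrow> \<omega> \<in> A"
      using determined \<omega>_space unfolding determined_by_def by metis
    then show ?thesis using restrict_space by (simp add: A'_def)
  qed
  moreover have "A \<subseteq> space (PiM I M)" using A_sets by (rule sets.sets_into_space)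
  moreover have "A' \<in> sets (PiM J M)"
    unfolding A'_def by (rule measurable_sets[OF e_measurable A_sets])
  ultimately show ?thesis by (intro bexI[of _ A']) auto
qed

lemma (in product_prob_space) measure_Int_determined_by_disjoint:
  assumes A_determined: "A \<in> sets (PiM I M)" "determined_by J A" "J \<subseteq> I"
    and B_determined: "B \<in> sets (PiM I M)" "determined_by K B" "K \<subseteq> I" and disjoint: "J \<inter> K = {}"
  shows "measure (PiM I M) (A \<inter> B) = measure (PiM I M) A * measure (PiM I M) B"
proof (cases "I = {}")
  case True
  have "A = {} \<or> A = space (PiM I M)" "B = {} \<or> B = space (PiM I M)"
    using sets.sets_into_space[OF A_determined(1)] sets.sets_into_space[OF B_determined(1)]
    by (auto simp: True space_PiM_empty)
  then show ?thesis using P.prob_space by auto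
next
  case False
  obtain A' where A'_vimage: "A' \<in> sets (PiM J M)" "(\<lambda>\<omega>. restrict \<omega> J) -` A' \<inter> space (PiM I M) = A"
    using determined_by_imp_vimage_restrict[OF A_determined] by blast
  obtain B' where B'_vimage: "B' \<in> sets (PiM K M)" "(\<lambda>\<omega>. restrict \<omega> K) -` B' \<inter> space (PiM I M) = B"
    using determined_by_imp_vimage_restrict[OF B_determined] by blast
  have "distr (PiM I M) (PiM I M) (\<lambda>\<omega>. \<lambda>i\<in>I. \<omega> i) = distr (PiM I M) (PiM I M) (\<lambda>\<omega>. \<omega>)"
    by (rule distr_cong) (auto simp: space_PiM PiE_restrict)
  also have "\<dots> = PiM I (\<lambda>i. distr (PiM I M) (M i) (\<lambda>\<omega>. \<omega> i))"
    by (simp add: distr_id PiM_component cong: PiM_cong)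
  finally have "P.indep_vars M (\<lambda>i \<omega>. \<omega> i) I"
    using False by (subst P.indep_vars_iff_distr_eq_PiM') auto
  then have "P.indep_var (PiM J M) (\<lambda>\<omega>. restrict \<omega> J) (PiM K M) (\<lambda>\<omega>. restrict \<omega> K)"
    using P.indep_var_restrict[of M "\<lambda>i \<omega>. \<omega> i" I J K] disjoint A_determined(3) B_determined(3)
    by simp
  from P.indep_varD[OF this A'_vimage(1) B'_vimage(1)]
  have "P.prob ((\<lambda>\<omega>. (restrict \<omega> J, restrict \<omega> K)) -` (A' \<times> B') \<inter> space (PiM I M))
      = P.prob A * P.prob B"
    by (simp only: A'_vimage(2) B'_vimage(2))
  moreover have "(\<lambda>\<omega>. (restrict \<omega> J, restrict \<omega> K)) -` (A' \<times> B') \<inter> space (PiM I M) = A \<inter> B"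
    using A'_vimage(2) B'_vimage(2) by auto
  ultimately show ?thesis by simp
qed

lemma (in prob_space) variance_sum_indicator_le:
  assumes finite_T: "finite T" and A_events: "\<And>i. i \<in> T \<Longrightarrow> A i \<in> events"
    and indep: "\<And>i j. i \<in> T \<Longrightarrow> j \<in> T \<Longrightarrow> \<not> R i j \<Longrightarrow> prob (A i \<inter> A j) = prob (A i) * prob (A j)"
  shows "variance (\<lambda>x. \<Sum>i\<in>T. indicator (A i) x) \<le> (\<Sum>(i, j)\<in>{(i, j)\<in>T \<times> T. R i j}. prob (A i \<inter> A j))"
proof -
  let ?X = "\<lambda>x. \<Sum>i\<in>T. indicator (A i) x :: real"
  let ?XX = "\<lambda>x. \<Sum>(i, j)\<in>T \<times> T. indicator (A i \<inter> A j) x :: real"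
  have integrable_indicator: "integrable M (indicator B :: 'a \<Rightarrow> real)" if "B \<in> events" for B
    using that by (intro integrable_real_indicator) (auto simp: emeasure_eq_measure)
  have expectation_indicator: "expectation (indicator B) = prob B" if "B \<in> events" for B
    using that sets.sets_into_space[OF that] by (simp add: Int_absorb2)
  have square_eq: "(?X x)\<^sup>2 = ?XX x" for x
    unfolding power2_eq_square sum_product sum.cartesian_product
    by (intro sum.cong) (auto simp: indicator_def)
  have "integrable M ?X"
    using A_events by (intro Bochner_Integration.integrable_sum integrable_indicator)
  moreover have "integrable M ?XX"
    using A_events by (intro Bochner_Integration.integrable_sum) (auto intro: integrable_indicator)
  ultimately have variance_decomp: "variance ?X = expectation ?XX - (expectation ?X)\<^sup>2"
    by (simp add: variance_eq square_eq)
  have "expectation ?X = (\<Sum>i\<in>T. prob (A i))"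
    using A_events
    by (subst Bochner_Integration.integral_sum)
      (auto intro!: integrable_indicator sum.cong expectation_indicator)
  then have "(expectation ?X)\<^sup>2 = (\<Sum>(i, j)\<in>T \<times> T. prob (A i) * prob (A j))"
    by (simp only: power2_eq_square sum_product sum.cartesian_product)
  moreover have "expectation ?XX = (\<Sum>(i, j)\<in>T \<times> T. prob (A i \<inter> A j))"
    using A_events
    by (subst Bochner_Integration.integral_sum)
      (auto intro!: integrable_indicator sum.cong expectation_indicator sets.Int)
  ultimately have "variance ?X = (\<Sum>(i, j)\<in>T \<times> T. prob (A i \<inter> A j) - prob (A i) * prob (A j))"
    by (simp only: variance_decomp) (simp add: sum_subtractf case_prod_beta)
  also have "\<dots> \<le> (\<Sum>(i, j)\<in>T \<times> T. if R i j then prob (A i \<inter> A j) else 0)"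
    using indep by (intro sum_mono) auto
  also have "\<dots> = (\<Sum>(i, j)\<in>{(i, j)\<in>T \<times> T. R i j}. prob (A i \<inter> A j))"
    using finite_T by (intro sum.mono_neutral_cong_right) (auto split: if_splits)
  finally show ?thesis .
qed

lemma (in prob_space) AE_tendsto_of_summable_variance:
  fixes X :: "nat \<Rightarrow> 'a \<Rightarrow> real"
  assumes [measurable]: "\<And>j. X j \<in> borel_measurable M"
    and square_integrable: "\<And>j. integrable M (\<lambda>x. (X j x)\<^sup>2)"
    and summable: "summable (\<lambda>j. variance (X j))"
    and lim: "(\<lambda>j. expectation (X j)) \<longlonglongrightarrow> L"
  shows "AE x in M. (\<lambda>j. X j x) \<longlonglongrightarrow> L"
proof -
  let ?Z = "\<lambda>j x. (X j x - expectation (X j))\<^sup>2"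
  have deviation_integrable: "integrable M (?Z j)" for j
    using square_integrable square_integrable_imp_integrable[OF _ square_integrable]
    unfolding power2_diff
    by (intro Bochner_Integration.integrable_add Bochner_Integration.integrable_diff) auto
  have "(\<integral>\<^sup>+x. (\<Sum>j. ennreal (?Z j x)) \<partial>M) = (\<Sum>j. \<integral>\<^sup>+x. ennreal (?Z j x) \<partial>M)"
    by (rule nn_integral_suminf) measurable
  also have "\<dots> = (\<Sum>j. ennreal (variance (X j)))"
    by (intro suminf_cong nn_integral_eq_integral deviation_integrable) auto
  also have "\<dots> = ennreal (\<Sum>j. variance (X j))"
    by (rule suminf_ennreal_eq[OF variance_positive summable_sums[OF summable]])
  finally have "(\<integral>\<^sup>+x. (\<Sum>j. ennreal (?Z j x)) \<partial>M) \<noteq> \<infinity>" by simp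
  then have "AE x in M. (\<Sum>j. ennreal (?Z j x)) \<noteq> \<infinity>"
    by (intro nn_integral_noteq_infinite) measurable
  then show ?thesis
  proof eventually_elim
    case (elim x)
    then have "summable (\<lambda>j. ?Z j x)" by (intro summable_suminf_not_top) auto
    then have "(\<lambda>j. sqrt (?Z j x)) \<longlonglongrightarrow> sqrt 0" by (intro tendsto_real_sqrt summable_LIMSEQ_zero)
    then have "(\<lambda>j. X j x - expectation (X j)) \<longlonglongrightarrow> 0" by (simp add: tendsto_rabs_zero_iff)
    from tendsto_add[OF this lim] show ?case by simp
  qed
qed

section \<open>Tuples\<close>

lemma finite_tuples: "finite (tuples k N)"
  unfolding tuples_def
  by (rule finite_subset[OF _ finite_lists_length_eq[of "{1..N}" k]]) auto

lemma card_tuples_1: "card (tuples 1 N) = N"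
proof -
  have "tuples 1 N = (\<lambda>a. [a]) ` {1..N}" by (auto simp: tuples_def length_Suc_conv)
  then show ?thesis by (simp add: card_image inj_on_def)
qed

lemma sum_tuples_Suc:
  fixes f :: "nat list \<Rightarrow> real"
  shows "(\<Sum>as\<in>tuples (Suc k) N. f as) = (\<Sum>as\<in>tuples k N. \<Sum>b\<in>{1..N} - set as. f (as @ [b]))"
proof -
  have "(\<Sum>as\<in>tuples k N. \<Sum>b\<in>{1..N} - set as. f (as @ [b]))
      = (\<Sum>(as, b)\<in>(SIGMA as:tuples k N. {1..N} - set as). f (as @ [b]))"
    by (intro sum.Sigma finite_tuples) auto
  also have "\<dots> = (\<Sum>as\<in>tuples (Suc k) N. f as)"
  proof (rule sum.reindex_bij_witness[where i = "\<lambda>as. (butlast as, last as)"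
        and j = "\<lambda>(as, b). as @ [b]"])
    fix as assume as_mem: "as \<in> tuples (Suc k) N"
    then obtain bs b where "as = bs @ [b]" unfolding tuples_def by (cases as rule: rev_cases) auto
    with as_mem show "(butlast as, last as) \<in> (SIGMA as:tuples k N. {1..N} - set as)"
      "(case (butlast as, last as) of (as, b) \<Rightarrow> as @ [b]) = as"
      by (auto simp: tuples_def)
  qed (auto simp: tuples_def)
  finally show ?thesis ..
qed

definition merge_tuples :: "nat list \<Rightarrow> nat list \<Rightarrow> nat list" where
  "merge_tuples as bs = as @ filter (\<lambda>b. b \<notin> set as) bs"

lemma set_merge_tuples: "set (merge_tuples as bs) = set as \<union> set bs"
  by (auto simp: merge_tuples_def)

lemma merge_tuples_nth_0: "as \<noteq> [] \<Longrightarrow> merge_tuples as bs ! 0 = as ! 0"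
  by (simp add: merge_tuples_def nth_append)

lemma merge_tuples_in_tuples:
  assumes as_mem: "as \<in> tuples k N" and bs_mem: "bs \<in> tuples k N" and meet: "set as \<inter> set bs \<noteq> {}"
  shows "\<exists>m\<in>{k..<2*k}. merge_tuples as bs \<in> tuples m N"
proof
  let ?f = "filter (\<lambda>b. b \<notin> set as) bs"
  obtain e where "e \<in> set as" "e \<in> set bs" using meet by blast
  then have "length ?f < length bs" by (intro length_filter_less[of e]) auto
  then show "length (merge_tuples as bs) \<in> {k..<2*k}"
    using as_mem bs_mem by (auto simp: merge_tuples_def tuples_def)
  show "merge_tuples as bs \<in> tuples (length (merge_tuples as bs)) N"
    using as_mem bs_mem by (auto simp: merge_tuples_def tuples_def)
qed

definition meeting_pairs :: "nat \<Rightarrow> nat \<Rightarrow> (nat list \<times> nat list) set" where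
  "meeting_pairs k N = {(as, bs) \<in> tuples k N \<times> tuples k N. set as \<inter> set bs \<noteq> {}}"

text \<open>The factor \<open>real m ^ k\<close> bounds the number of pairs that merge into the same tuple.\<close>

lemma sum_merge_tuples_le:
  fixes f :: "nat list \<Rightarrow> real"
  assumes f_nonneg: "\<And>cs. 0 \<le> f cs"
  shows "(\<Sum>(as, bs)\<in>meeting_pairs k N. f (merge_tuples as bs))
    \<le> (\<Sum>m\<in>{k..<2*k}. real m ^ k * (\<Sum>cs\<in>tuples m N. f cs))" (is "sum ?g ?S \<le> _")
proof -
  define W where "W = (\<Union>m\<in>{k..<2*k}. tuples m N)"
  define fiber where "fiber = (\<lambda>cs::nat list. {bs. set bs \<subseteq> set cs \<and> length bs = k})"
  define \<phi> where "\<phi> = (\<lambda>(as, bs). (merge_tuples as bs, bs))"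
  have finite_W: "finite W" unfolding W_def by (auto intro: finite_tuples)
  have finite_fiber: "finite (fiber cs)" for cs
    unfolding fiber_def by (rule finite_lists_length_eq) simp
  have inj_merge: "inj_on \<phi> ?S"
    by (auto simp: inj_on_def \<phi>_def meeting_pairs_def merge_tuples_def tuples_def)
  have image_subset: "\<phi> ` ?S \<subseteq> Sigma W fiber"
  proof
    fix q assume "q \<in> \<phi> ` ?S"
    then obtain as bs where q_eq: "q = (merge_tuples as bs, bs)" "as \<in> tuples k N" "bs \<in> tuples k N"
      "set as \<inter> set bs \<noteq> {}"
      by (auto simp: \<phi>_def meeting_pairs_def)
    then have "merge_tuples as bs \<in> W"
      using merge_tuples_in_tuples[of as k N bs] by (auto simp: W_def)
    moreover have "bs \<in> fiber (merge_tuples as bs)"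
      using q_eq(3) by (simp add: fiber_def set_merge_tuples tuples_def)
    ultimately show "q \<in> Sigma W fiber" using q_eq(1) by simp
  qed
  have "sum ?g ?S = (\<Sum>q\<in>\<phi> ` ?S. f (fst q))"
    by (subst sum.reindex[OF inj_merge]) (auto simp: \<phi>_def intro!: sum.cong)
  also have "\<dots> \<le> (\<Sum>q\<in>Sigma W fiber. f (fst q))"
    using f_nonneg by (intro sum_mono2 finite_SigmaI finite_W finite_fiber image_subset) auto
  also have "\<dots> = (\<Sum>cs\<in>W. \<Sum>bs\<in>fiber cs. f cs)"
    using finite_W finite_fiber by (subst sum.Sigma) (auto simp: case_prod_beta)
  also have "\<dots> = (\<Sum>cs\<in>W. real (card (set cs) ^ k) * f cs)"
    unfolding fiber_def by (simp add: card_lists_length_eq)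
  also have "\<dots> = (\<Sum>m\<in>{k..<2*k}. \<Sum>cs\<in>tuples m N. real (card (set cs) ^ k) * f cs)"
    unfolding W_def
    by (intro sum.UNION_disjoint) (simp_all add: finite_tuples, auto simp: tuples_def)
  also have "\<dots> = (\<Sum>m\<in>{k..<2*k}. real m ^ k * (\<Sum>cs\<in>tuples m N. f cs))"
    unfolding sum_distrib_left by (intro sum.cong refl) (auto simp: tuples_def distinct_card)
  finally show ?thesis .
qed

section \<open>Expected correlation sums\<close>

abbreviation Unif :: "(nat \<Rightarrow> real) measure" where
  "Unif \<equiv> Pi\<^sub>M UNIV (\<lambda>_. unif)"

interpretation Unif: product_prob_space "\<lambda>_::nat. unif" UNIV
  by (intro product_prob_spaceI prob_space_unif)

lemma space_Unif [simp]: "space Unif = UNIV"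
  by (simp add: space_PiM)

lemma measurable_Unif_component [measurable]: "(\<lambda>\<omega>. \<omega> n) \<in> borel_measurable Unif"
proof -
  have "(\<lambda>\<omega>. \<omega> n) \<in> measurable Unif unif" by simp
  then show ?thesis by (simp cong: measurable_cong_sets)
qed

lemma integrable_indicator_Unif: "A \<in> sets Unif \<Longrightarrow> integrable Unif (indicator A :: _ \<Rightarrow> real)"
  by (intro integrable_real_indicator) (auto simp: Unif.P.emeasure_eq_measure)

definition box_volume :: "nat \<Rightarrow> (nat \<Rightarrow> real) \<Rightarrow> real" where
  "box_volume k s = (\<Prod>i\<in>{1..k-1}. s (2*i) - s (2*i - 1))"

abbreviation in_box :: "(nat \<Rightarrow> real) \<Rightarrow> nat \<Rightarrow> nat \<Rightarrow> real \<Rightarrow> bool" where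
  "in_box s N i y \<equiv> in_mod1 y (s (2*i - 1) / real N) (s (2*i) / real N)"

lemma box_volume_Suc: "1 \<le> k \<Longrightarrow> box_volume (Suc k) s = (s (2*k) - s (2*k - 1)) * box_volume k s"
  by (cases k) (simp_all add: box_volume_def)

context perturbed_rotation
begin

lemma eventually_sum_hit_prob_scaled:
  assumes l_less_h: "l < h" and \<eta>_pos: "\<eta> > 0"
  shows "\<forall>\<^sub>F N in sequentially. \<forall>y S. S \<subseteq> {1..N} \<and> card S = m \<longrightarrow>
    \<bar>(\<Sum>b\<in>{1..N} - S. hit_prob y (l / real N) (h / real N) b) - (h - l)\<bar> \<le> \<eta>"
proof -
  define \<delta> where "\<delta> = \<eta> / ((real m + 1) * (h - l))"
  have \<delta>_eq: "0 < \<delta>" "(real m + 1) * (\<delta> * (h - l)) = \<eta>"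
    using l_less_h \<eta>_pos by (simp_all add: \<delta>_def)
  have "(\<lambda>N. (h - l) / real N) \<longlonglongrightarrow> 0" by real_asymp
  from order_tendstoD(2)[OF this, of "1/2"]
  have "\<forall>\<^sub>F N in sequentially. (h - l) / real N < 1/2" by simp
  with eventually_sum_hit_prob[OF \<delta>_eq(1)] eventually_hit_prob_small[OF \<delta>_eq(1)] eventually_gt_at_top[of 0]
  show ?thesis
  proof eventually_elim
    case (elim N)
    let ?f = "\<lambda>y b. hit_prob y (l / real N) (h / real N) b"
    have arc_length: "h / real N - l / real N = (h - l) / real N" by (simp add: diff_divide_distrib)
    have scale: "real N * ((h - l) / real N) = h - l" using elim(3) by simp
    have short: "l / real N \<le> h / real N" "(h - l) / real N \<le> 1/2" "(h - l) / real N \<le> 1"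
      using l_less_h elim(3,4) by (auto simp: divide_right_mono)
    show ?case
    proof (intro allI impI)
      fix y S assume S_subset: "S \<subseteq> {1..N} \<and> card S = m"
      have "\<bar>(\<Sum>b\<in>{1..N}. ?f y b) - (h - l)\<bar> \<le> \<delta> * (h - l)"
        using elim(1) short by (metis arc_length scale)
      moreover have "?f y b \<le> \<delta> * (h - l)" if "b \<in> S" for b
        using elim(2) short S_subset that by (metis arc_length scale subsetD)
      then have "(\<Sum>b\<in>S. ?f y b) \<le> real (card S) * (\<delta> * (h - l))" by (rule sum_bounded_above)
      moreover have "0 \<le> (\<Sum>b\<in>S. ?f y b)" by (intro sum_nonneg hit_prob_nonneg)
      moreover have "(\<Sum>b\<in>{1..N} - S. ?f y b) = (\<Sum>b\<in>{1..N}. ?f y b) - (\<Sum>b\<in>S. ?f y b)"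
        using S_subset by (intro sum_diff) auto
      moreover have "real m * (\<delta> * (h - l)) + \<delta> * (h - l) = \<eta>"
        using \<delta>_eq(2) by (simp add: algebra_simps)
      ultimately show "\<bar>(\<Sum>b\<in>{1..N} - S. ?f y b) - (h - l)\<bar> \<le> \<eta>"
        using S_subset by (simp add: abs_le_iff)
    qed
  qed
qed

abbreviation box_hit_prob :: "(nat \<Rightarrow> real) \<Rightarrow> nat \<Rightarrow> nat \<Rightarrow> real \<Rightarrow> nat \<Rightarrow> real" where
  "box_hit_prob s N i y b \<equiv> hit_prob y (s (2*i - 1) / real N) (s (2*i) / real N) b"

definition point :: "(nat \<Rightarrow> real) \<Rightarrow> nat \<Rightarrow> real" where
  "point \<omega> n = \<alpha> * perturbed_seq G \<omega> n"

lemma measurable_point [measurable]: "(\<lambda>\<omega>. point \<omega> n) \<in> borel_measurable Unif"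
  unfolding point_def perturbed_seq_def by measurable

definition close :: "(nat \<Rightarrow> real) \<Rightarrow> nat \<Rightarrow> nat list \<Rightarrow> (nat \<Rightarrow> real) set" where
  "close s N as = {\<omega>. \<forall>i\<in>{1..length as - 1}.
     in_box s N i (point \<omega> (as ! 0) - point \<omega> (as ! i))}"

lemma sets_close [measurable]: "close s N as \<in> sets Unif"
proof -
  have "close s N as = {\<omega> \<in> space Unif. \<forall>i\<in>{1..length as - 1}.
     in_box s N i (point \<omega> (as ! 0) - point \<omega> (as ! i))}"
    by (simp add: close_def)
  also have "\<dots> \<in> sets Unif" by measurable
  finally show ?thesis .
qed

lemma close_cong:
  assumes "\<And>a. a \<in> set as \<Longrightarrow> \<omega> a = \<omega>' a"
  shows "\<omega> \<in> close s N as \<longleftrightarrow> \<omega>' \<in> close s N as"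
proof -
  have point_eq: "point \<omega> (as ! i) = point \<omega>' (as ! i)" if "i < length as" for i
    using assms[OF nth_mem[OF that]] by (simp add: point_def perturbed_seq_def)
  have "point \<omega> (as ! 0) - point \<omega> (as ! i) = point \<omega>' (as ! 0) - point \<omega>' (as ! i)"
    if "i \<in> {1..length as - 1}" for i
  proof -
    have "i < length as" "0 < length as" using that by auto
    then show ?thesis by (simp only: point_eq)
  qed
  then show ?thesis by (simp add: close_def)
qed

lemma close_snoc_iff:
  assumes "as \<noteq> []"
  shows "\<omega> \<in> close s N (as @ [b]) \<longleftrightarrow> \<omega> \<in> close s N as \<and>
    in_box s N (length as) (point \<omega> (as ! 0) - point \<omega> b)"
proof -
  have "{1..length (as @ [b]) - 1} = insert (length as) {1..length as - 1}"
    using assms by (cases as) auto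
  moreover have "(as @ [b]) ! i = as ! i" if "i \<in> {1..length as - 1}" for i
    using that by (auto simp: nth_append)
  moreover have "(as @ [b]) ! 0 = as ! 0" using assms by (simp add: nth_append)
  ultimately show ?thesis by (auto simp: close_def)
qed

lemma measure_close_snoc:
  fixes s :: "nat \<Rightarrow> real" and N :: nat
  assumes b_notin: "b \<notin> set as" and nonempty: "as \<noteq> []"
  defines "f \<equiv> \<lambda>\<omega>. indicator (close s N as) \<omega> *
    box_hit_prob s N (length as) (point \<omega> (as ! 0)) b"
  shows "measure Unif (close s N (as @ [b])) = (\<integral>\<omega>. f \<omega> \<partial>Unif)" and "integrable Unif f"
proof -
  let ?lo = "s (2 * length as - 1) / real N" and ?hi = "s (2 * length as) / real N"
  have mem_iff: "fun_upd \<omega> b t \<in> close s N (as @ [b]) \<longleftrightarrow> \<omega> \<in> close s N as \<and>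
      in_mod1 (point \<omega> (as ! 0) - 2 * \<alpha> * real b - \<alpha> * G (floor_log b) * t) ?lo ?hi" for \<omega> t
  proof -
    have "as ! 0 \<noteq> b" using b_notin nonempty by (metis length_greater_0_conv nth_mem)
    then have "point (fun_upd \<omega> b t) (as ! 0) - point (fun_upd \<omega> b t) b
        = point \<omega> (as ! 0) - 2 * \<alpha> * real b - \<alpha> * G (floor_log b) * t"
      by (simp add: point_def perturbed_seq_def algebra_simps)
    moreover have "fun_upd \<omega> b t \<in> close s N as \<longleftrightarrow> \<omega> \<in> close s N as"
      using b_notin by (intro close_cong) auto
    ultimately show ?thesis by (simp add: close_snoc_iff[OF nonempty])
  qed
  have slice: "measure unif {t \<in> space unif. fun_upd \<omega> b t \<in> close s N (as @ [b])} = f \<omega>" for \<omega>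
    by (simp add: f_def mem_iff hit_prob_def arc_prob_def indicator_def)
  note resample = Unif.measure_PiM_resample[where i = b, OF UNIV_I sets_close[of s N "as @ [b]"],
      unfolded slice]
  show "measure Unif (close s N (as @ [b])) = (\<integral>\<omega>. f \<omega> \<partial>Unif)" by (rule resample(1))
  have "f \<omega> = measure unif {t \<in> space unif. fun_upd \<omega> b t \<in> close s N (as @ [b])}" for \<omega>
    by (simp only: slice)
  then have "norm (f \<omega>) \<le> 1" for \<omega> by simp
  then show "integrable Unif f"
    using resample(2) by (intro Unif.P.integrable_const_bound[of _ 1]) auto
qed

lemma sum_measure_close_snoc:
  assumes nonempty: "as \<noteq> []" and B_disjoint: "finite B" "B \<inter> set as = {}"
    and near: "\<And>y. \<bar>(\<Sum>b\<in>B. box_hit_prob s N (length as) y b) - v\<bar> \<le> \<eta>"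
  shows "\<bar>(\<Sum>b\<in>B. measure Unif (close s N (as @ [b]))) - v * measure Unif (close s N as)\<bar>
      \<le> \<eta> * measure Unif (close s N as)"
proof -
  let ?I = "indicator (close s N as) :: _ \<Rightarrow> real"
  let ?h = "\<lambda>\<omega> b. box_hit_prob s N (length as) (point \<omega> (as ! 0)) b"
  have B_notin: "b \<notin> set as" if "b \<in> B" for b using that B_disjoint(2) by auto
  have integrable_sum: "integrable Unif (\<lambda>\<omega>. \<Sum>b\<in>B. ?I \<omega> * ?h \<omega> b)"
    using measure_close_snoc(2)[OF B_notin nonempty] by (rule Bochner_Integration.integrable_sum)
  have integrable_close: "integrable Unif (\<lambda>\<omega>. c * ?I \<omega>)" for c
    by (intro integrable_mult_right integrable_indicator_Unif sets_close)
  have integral_close: "(\<integral>\<omega>. c * ?I \<omega> \<partial>Unif) = c * measure Unif (close s N as)" for c by simp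
  have "(\<Sum>b\<in>B. measure Unif (close s N (as @ [b]))) = (\<integral>\<omega>. (\<Sum>b\<in>B. ?I \<omega> * ?h \<omega> b) \<partial>Unif)"
    using measure_close_snoc[OF B_notin nonempty]
    by (subst Bochner_Integration.integral_sum) (auto intro: sum.cong)
  then have "\<bar>(\<Sum>b\<in>B. measure Unif (close s N (as @ [b]))) - v * measure Unif (close s N as)\<bar>
      = \<bar>\<integral>\<omega>. (\<Sum>b\<in>B. ?I \<omega> * ?h \<omega> b) - v * ?I \<omega> \<partial>Unif\<bar>"
    by (simp only: Bochner_Integration.integral_diff[OF integrable_sum integrable_close]
        integral_close)
  also have "\<dots> \<le> (\<integral>\<omega>. \<bar>(\<Sum>b\<in>B. ?I \<omega> * ?h \<omega> b) - v * ?I \<omega>\<bar> \<partial>Unif)"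
    by (rule integral_abs_bound)
  also have "\<dots> \<le> (\<integral>\<omega>. \<eta> * ?I \<omega> \<partial>Unif)"
  proof (intro integral_mono integrable_close integrable_abs Bochner_Integration.integrable_diff
        integrable_sum)
    show "\<bar>(\<Sum>b\<in>B. ?I \<omega> * ?h \<omega> b) - v * ?I \<omega>\<bar> \<le> \<eta> * ?I \<omega>" for \<omega>
      using near by (simp add: indicator_def)
  qed
  finally show ?thesis by (simp only: integral_close)
qed

definition mean_corr :: "nat \<Rightarrow> (nat \<Rightarrow> real) \<Rightarrow> nat \<Rightarrow> real" where
  "mean_corr k s N = (\<Sum>as\<in>tuples k N. measure Unif (close s N as))"

lemma mean_corr_nonneg: "0 \<le> mean_corr k s N"
  unfolding mean_corr_def by (intro sum_nonneg) simp

lemma mean_corr_1: "mean_corr 1 s N = real N"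
proof -
  have "measure Unif (close s N as) = 1" if "as \<in> tuples 1 N" for as
    using that Unif.P.prob_space by (simp add: close_def tuples_def)
  then show ?thesis by (simp add: mean_corr_def card_tuples_1 del: One_nat_def)
qed

lemma mean_corr_Suc_smallo:
  assumes m_ge_1: "1 \<le> m" and gap: "s (2*m - 1) < s (2*m)"
  shows "(\<lambda>N. mean_corr (Suc m) s N - (s (2*m) - s (2*m - 1)) * mean_corr m s N)
      \<in> o(\<lambda>N. mean_corr m s N)"
proof (rule landau_o.smallI)
  fix \<eta> :: real assume "\<eta> > 0"
  from eventually_sum_hit_prob_scaled[OF gap this, of m]
  show "\<forall>\<^sub>F N in sequentially.
      norm (mean_corr (Suc m) s N - (s (2*m) - s (2*m - 1)) * mean_corr m s N)
      \<le> \<eta> * norm (mean_corr m s N)"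
  proof eventually_elim
    case (elim N)
    let ?P = "\<lambda>as. measure Unif (close s N as)"
    have "\<bar>(\<Sum>b\<in>{1..N} - set as. ?P (as @ [b])) - (s (2*m) - s (2*m - 1)) * ?P as\<bar> \<le> \<eta> * ?P as"
      if "as \<in> tuples m N" for as
    proof (rule sum_measure_close_snoc)
      have as_tuple: "length as = m" "set as \<subseteq> {1..N}" "card (set as) = m"
        using that by (auto simp: tuples_def distinct_card)
      show "as \<noteq> []" using as_tuple(1) m_ge_1 by auto
      show "\<bar>(\<Sum>b\<in>{1..N} - set as. box_hit_prob s N (length as) y b)
          - (s (2*m) - s (2*m - 1))\<bar> \<le> \<eta>" for y
        using elim as_tuple by simp
    qed auto
    then have "\<bar>\<Sum>as\<in>tuples m N.
          (\<Sum>b\<in>{1..N} - set as. ?P (as @ [b])) - (s (2*m) - s (2*m - 1)) * ?P as\<bar>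
        \<le> (\<Sum>as\<in>tuples m N. \<eta> * ?P as)"
      by (intro order_trans[OF sum_abs] sum_mono)
    then show ?case
      using mean_corr_nonneg[of m s N]
      by (simp add: mean_corr_def sum_tuples_Suc sum_subtractf sum_distrib_left)
  qed
qed

lemma tendsto_mean_corr:
  assumes "1 \<le> k" and "admissible k s"
  shows "(\<lambda>N. mean_corr k s N / real N) \<longlonglongrightarrow> box_volume k s"
  using assms
proof (induction k rule: dec_induct)
  case base
  have "\<forall>\<^sub>F N in sequentially. 1 = mean_corr 1 s N / real N"
    using eventually_gt_at_top[of 0] by eventually_elim (simp add: mean_corr_1 del: One_nat_def)
  then show ?case by (simp add: box_volume_def tendsto_eventually eventually_mono)
next
  case (step m)
  let ?v = "s (2*m) - s (2*m - 1)"
  let ?d = "\<lambda>N. mean_corr (Suc m) s N - ?v * mean_corr m s N"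
  have gap: "s (2*m - 1) < s (2*m)" and "admissible m s"
    using step by (auto simp: admissible_def)
  then have IH: "(\<lambda>N. mean_corr m s N / real N) \<longlonglongrightarrow> box_volume m s" by (intro step.IH)
  have "?d \<in> o(\<lambda>N. mean_corr m s N)" by (rule mean_corr_Suc_smallo[OF step.hyps(1) gap])
  also have "(\<lambda>N. mean_corr m s N) \<in> O(\<lambda>N. real N)"
    using IH eventually_gt_at_top[of 0] by (intro bigoI_tendsto) (auto elim: eventually_mono)
  finally have "(\<lambda>N. ?d N / real N) \<longlonglongrightarrow> 0" by (rule smalloD_tendsto)
  from tendsto_add[OF tendsto_mult_left[OF IH, of ?v] this] show ?case
    by (simp add: box_volume_Suc[OF step.hyps(1)] diff_divide_distrib)
qed

section \<open>Variance of the correlation sums\<close>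

lemma corr_count_eq_sum_indicator:
  "real (corr_count k (point \<omega>) s N) = (\<Sum>as\<in>tuples k N. indicator (close s N as) \<omega>)"
proof -
  have "{as \<in> tuples k N. \<forall>i\<in>{1..k-1}. in_box s N i (point \<omega> (as ! 0) - point \<omega> (as ! i))}
      = {as \<in> tuples k N. \<omega> \<in> close s N as}"
    by (auto simp: close_def tuples_def)
  then show ?thesis
    using finite_tuples[of k N] by (simp add: corr_count_def indicator_def sum.If_cases Int_def)
qed

lemma expectation_corr_count: "(\<integral>\<omega>. real (corr_count k (point \<omega>) s N) \<partial>Unif) = mean_corr k s N"
  unfolding corr_count_eq_sum_indicator mean_corr_def
  by (subst Bochner_Integration.integral_sum) (auto intro: integrable_indicator_Unif sets_close)

lemma measurable_corr_count [measurable]: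
  "(\<lambda>\<omega>. real (corr_count k (point \<omega>) s N)) \<in> borel_measurable Unif"
  unfolding corr_count_eq_sum_indicator by measurable

lemma integrable_corr_count_square: "integrable Unif (\<lambda>\<omega>. (real (corr_count k (point \<omega>) s N))\<^sup>2)"
proof (rule Unif.P.integrable_const_bound)
  have "corr_count k (point \<omega>) s N \<le> card (tuples k N)" for \<omega>
    unfolding corr_count_def by (intro card_mono finite_tuples) auto
  then show "AE \<omega> in Unif. norm ((real (corr_count k (point \<omega>) s N))\<^sup>2)
      \<le> (real (card (tuples k N)))\<^sup>2"
    by (simp add: power_mono)
qed measurable

lemma measure_close_Int_disjoint:
  assumes "set as \<inter> set bs = {}"
  shows "measure Unif (close s N as \<inter> close s N bs)
      = measure Unif (close s N as) * measure Unif (close s N bs)"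
proof -
  have "Unif.determined_by (set cs) (close s N cs)" for cs
    unfolding Unif.determined_by_def by (metis close_cong)
  then show ?thesis
    using assms
    by (intro Unif.measure_Int_determined_by_disjoint[of _ "set as" _ "set bs"] sets_close) auto
qed

definition symmetric_box :: "real \<Rightarrow> nat \<Rightarrow> real" where
  "symmetric_box r n = (if even n then r else - r)"

lemma in_mod1_of_close:
  assumes \<omega>_close: "\<omega> \<in> close s N as" and c_mem: "c \<in> set as"
    and s_bound: "\<And>n. n < 2 * length as \<Longrightarrow> \<bar>s n\<bar> \<le> r"
  shows "in_mod1 (point \<omega> (as ! 0) - point \<omega> c) (- (r / real N)) (r / real N)"
proof -
  obtain i where c_nth: "i < length as" "c = as ! i" using c_mem by (auto simp: in_set_conv_nth)
  show ?thesis
  proof (cases "i = 0")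
    case True
    have "\<bar>s 0\<bar> \<le> r" using c_nth by (intro s_bound) auto
    then have "0 \<le> r" by linarith
    then show ?thesis using True c_nth by (auto intro: in_mod1I)
  next
    case False
    then have "in_box s N i (point \<omega> (as ! 0) - point \<omega> c)"
      using \<omega>_close c_nth unfolding close_def by auto
    moreover have "\<bar>s (2*i - 1)\<bar> \<le> r" "\<bar>s (2*i)\<bar> \<le> r" using c_nth by (auto intro: s_bound)
    then have "- r \<le> s (2*i - 1)" "s (2*i) \<le> r" by linarith+
    then have "- (r / real N) \<le> s (2*i - 1) / real N" "s (2*i) / real N \<le> r / real N"
      unfolding minus_divide_left by (simp_all only: divide_right_mono of_nat_0_le_iff)
    ultimately show ?thesis by (rule in_mod1_mono)
  qed
qed

lemma close_Int_subset_close_merge: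
  assumes s_bound: "\<And>n. n < 2 * k \<Longrightarrow> \<bar>s n\<bar> \<le> r" and lengths: "length as = k" "length bs = k"
    and meet: "set as \<inter> set bs \<noteq> {}"
  shows "close s N as \<inter> close s N bs \<subseteq> close (symmetric_box (3 * r)) N (merge_tuples as bs)"
proof
  fix \<omega> assume \<omega>_close: "\<omega> \<in> close s N as \<inter> close s N bs"
  let ?q = "r / real N"
  have near_as: "in_mod1 (point \<omega> (as ! 0) - point \<omega> c) (- ?q) ?q" if "c \<in> set as" for c
    using \<omega>_close that s_bound lengths by (intro in_mod1_of_close[of _ s]) auto
  have near_bs: "in_mod1 (point \<omega> (bs ! 0) - point \<omega> c) (- ?q) ?q" if "c \<in> set bs" for c
    using \<omega>_close that s_bound lengths by (intro in_mod1_of_close[of _ s]) auto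
  obtain e where e_common: "e \<in> set as" "e \<in> set bs" using meet by blast
  then have "as \<noteq> []" by auto
  then have "\<bar>s 0\<bar> \<le> r" using lengths(1) by (intro s_bound) auto
  then have q_nonneg: "0 \<le> ?q" by (intro divide_nonneg_nonneg) auto
  have near: "in_mod1 (point \<omega> (as ! 0) - point \<omega> c) (- (3 * ?q)) (3 * ?q)"
    if c_mem: "c \<in> set as \<union> set bs" for c
  proof (cases "c \<in> set as")
    case True
    show ?thesis by (rule in_mod1_mono[OF near_as[OF True]]) (use q_nonneg in linarith)+
  next
    case False
    with c_mem have "c \<in> set bs" by blast
    have "in_mod1 (- (point \<omega> (bs ! 0) - point \<omega> e)) (- ?q) ?q"
      unfolding in_mod1_uminus using near_bs[OF e_common(2)] by simp
    from in_mod1_add[OF in_mod1_add[OF near_as[OF e_common(1)] this] near_bs[OF \<open>c \<in> set bs\<close>]]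
    show ?thesis by (simp add: algebra_simps)
  qed
  have "merge_tuples as bs ! i \<in> set as \<union> set bs"
    if "i \<in> {1..length (merge_tuples as bs) - 1}" for i
    using that by (intro nth_mem[of i "merge_tuples as bs", unfolded set_merge_tuples]) auto
  then show "\<omega> \<in> close (symmetric_box (3 * r)) N (merge_tuples as bs)"
    using near
    unfolding close_def merge_tuples_nth_0[OF \<open>as \<noteq> []\<close>] by (auto simp: symmetric_box_def)
qed

text \<open>Two close tuples sharing an entry merge into a single close tuple of length below \<open>2 * k\<close>, so
  they contribute as little to the variance as single tuples do to the mean.\<close>

lemma variance_corr_count_le:
  assumes s_bound: "\<And>n. n < 2 * k \<Longrightarrow> \<bar>s n\<bar> \<le> r"
  shows "Unif.P.variance (\<lambda>\<omega>. real (corr_count k (point \<omega>) s N))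
    \<le> (\<Sum>m\<in>{k..<2*k}. real m ^ k * mean_corr m (symmetric_box (3 * r)) N)"
proof -
  have "Unif.P.variance (\<lambda>\<omega>. real (corr_count k (point \<omega>) s N))
      \<le> (\<Sum>(as, bs)\<in>meeting_pairs k N. measure Unif (close s N as \<inter> close s N bs))"
    unfolding corr_count_eq_sum_indicator meeting_pairs_def
    by (intro Unif.P.variance_sum_indicator_le finite_tuples sets_close measure_close_Int_disjoint) simp
  also have "\<dots> \<le> (\<Sum>(as, bs)\<in>meeting_pairs k N.
      measure Unif (close (symmetric_box (3 * r)) N (merge_tuples as bs)))"
  proof (rule sum_mono, clarify)
    fix as bs assume "(as, bs) \<in> meeting_pairs k N"
    then have "as \<in> tuples k N" "bs \<in> tuples k N" "set as \<inter> set bs \<noteq> {}"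
      by (auto simp: meeting_pairs_def)
    then show "measure Unif (close s N as \<inter> close s N bs)
        \<le> measure Unif (close (symmetric_box (3 * r)) N (merge_tuples as bs))"
      using s_bound
      by (intro Unif.P.finite_measure_mono close_Int_subset_close_merge[of k] sets_close)
        (auto simp: tuples_def)
  qed
  also have "\<dots> \<le> (\<Sum>m\<in>{k..<2*k}. real m ^ k * mean_corr m (symmetric_box (3 * r)) N)"
    unfolding mean_corr_def by (rule sum_merge_tuples_le) simp
  finally show ?thesis .
qed

lemma variance_corr_count_bigo:
  assumes k_ge_1: "1 \<le> k"
  shows "(\<lambda>N. Unif.P.variance (\<lambda>\<omega>. real (corr_count k (point \<omega>) s N))) \<in> O(\<lambda>N. real N)"
proof -
  define r where "r = 1 + (\<Sum>n<2*k. \<bar>s n\<bar>)"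
  have r_bound: "\<bar>s n\<bar> \<le> r" if "n < 2 * k" for n
    using member_le_sum[of n "{..<2*k}" "\<lambda>n. \<bar>s n\<bar>"] that by (simp add: r_def)
  have "r > 0" by (simp add: r_def add_pos_nonneg sum_nonneg)
  have mean_bigo: "(\<lambda>N. mean_corr m (symmetric_box (3 * r)) N) \<in> O(\<lambda>N. real N)"
    if "m \<in> {k..<2*k}" for m
  proof (rule bigoI_tendsto)
    have "admissible m (symmetric_box (3 * r))"
      using \<open>r > 0\<close> by (auto simp: admissible_def symmetric_box_def)
    then show "(\<lambda>N. mean_corr m (symmetric_box (3 * r)) N / real N)
        \<longlonglongrightarrow> box_volume m (symmetric_box (3 * r))"
      using that k_ge_1 by (intro tendsto_mean_corr) auto
    show "\<forall>\<^sub>F N in sequentially. real N \<noteq> 0"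
      using eventually_gt_at_top[of 0] by eventually_elim simp
  qed
  have "norm (Unif.P.variance (\<lambda>\<omega>. real (corr_count k (point \<omega>) s N)))
      \<le> norm (\<Sum>m\<in>{k..<2*k}. real m ^ k * mean_corr m (symmetric_box (3 * r)) N)" for N
    using variance_corr_count_le[of k s r N, OF r_bound]
      Unif.P.variance_positive[of "\<lambda>\<omega>. real (corr_count k (point \<omega>) s N)"] by simp
  then have "(\<lambda>N. Unif.P.variance (\<lambda>\<omega>. real (corr_count k (point \<omega>) s N)))
      \<in> O(\<lambda>N. \<Sum>m\<in>{k..<2*k}. real m ^ k * mean_corr m (symmetric_box (3 * r)) N)"
    by (intro landau_o.big_mono always_eventually allI)
  also have "(\<lambda>N. \<Sum>m\<in>{k..<2*k}. real m ^ k * mean_corr m (symmetric_box (3 * r)) N) \<in> O(\<lambda>N. real N)"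
    using mean_bigo by (intro big_sum_in_bigo) auto
  finally show ?thesis .
qed

lemma AE_corr_count_squares:
  assumes k_ge_1: "1 \<le> k" and s_admissible: "admissible k s"
  shows "AE \<omega> in Unif. (\<lambda>j. real (corr_count k (point \<omega>) s (j\<^sup>2)) / real (j\<^sup>2)) \<longlonglongrightarrow> box_volume k s"
proof (rule Unif.P.AE_tendsto_of_summable_variance)
  let ?X = "\<lambda>N \<omega>. real (corr_count k (point \<omega>) s N)"
  have squares: "filterlim (\<lambda>j::nat. j\<^sup>2) at_top sequentially"
    by (intro filterlim_subseq strict_monoI) (simp add: power_strict_mono)
  show "(\<lambda>j. \<integral>\<omega>. ?X (j\<^sup>2) \<omega> / real (j\<^sup>2) \<partial>Unif) \<longlonglongrightarrow> box_volume k s"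
    using filterlim_compose[OF tendsto_mean_corr[OF k_ge_1 s_admissible] squares]
    by (simp add: expectation_corr_count)
  have "\<forall>\<^sub>F j in sequentially. (real (j\<^sup>2))\<^sup>2 \<noteq> 0"
    using eventually_gt_at_top[of 0] by eventually_elim simp
  then have "(\<lambda>j. Unif.P.variance (?X (j\<^sup>2)) / (real (j\<^sup>2))\<^sup>2) \<in> O(\<lambda>j. real (j\<^sup>2) / (real (j\<^sup>2))\<^sup>2)"
    by (intro landau_o.big.divide_right
        landau_o.big.compose[OF variance_corr_count_bigo[OF k_ge_1] squares])
  also have "(\<lambda>j. real (j\<^sup>2) / (real (j\<^sup>2))\<^sup>2) = (\<lambda>j. inverse (real j ^ 2))"
    by (auto simp: power2_eq_square field_simps)
  finally have "summable (\<lambda>j. Unif.P.variance (?X (j\<^sup>2)) / (real (j\<^sup>2))\<^sup>2)"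
    by (rule summable_comparison_test_bigo[rotated])
      (use inverse_power_summable[of 2, where 'a = real] in simp)
  moreover have "Unif.P.variance (\<lambda>\<omega>. ?X N \<omega> / c) = Unif.P.variance (?X N) / c\<^sup>2" for N c
    by (simp add: power_divide flip: diff_divide_distrib)
  ultimately show "summable (\<lambda>j. Unif.P.variance (\<lambda>\<omega>. ?X (j\<^sup>2) \<omega> / real (j\<^sup>2)))"
    by (simp only:)
  show "integrable Unif (\<lambda>\<omega>. (?X (j\<^sup>2) \<omega> / real (j\<^sup>2))\<^sup>2)" for j
    using integrable_corr_count_square by (simp add: power_divide)
qed measurable

end

section \<open>From squares and rational boxes to the full limit\<close>

lemma poissonian_corr_iff_box_volume:
  "poissonian_corr k y \<longleftrightarrow>
     (\<forall>s. admissible k s \<longrightarrow> (\<lambda>N. real (corr_count k y s N) / real N) \<longlonglongrightarrow> box_volume k s)"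
  by (simp add: poissonian_corr_def box_volume_def)

text \<open>Index \<open>0\<close> bounds no interval of the box; including it makes the condition uniform in \<open>n\<close>.\<close>

definition box_inside :: "nat \<Rightarrow> (nat \<Rightarrow> real) \<Rightarrow> (nat \<Rightarrow> real) \<Rightarrow> bool" where
  "box_inside k s t \<longleftrightarrow> (\<forall>n<2*k. if odd n then t n < s n else s n < t n)"

lemma box_insideD:
  assumes "box_inside k s t" "1 \<le> i" "i < k"
  shows "t (2*i - 1) < s (2*i - 1)" "s (2*i) < t (2*i)"
proof -
  have "2*i - 1 < 2*k" "odd (2*i - 1)" "2*i < 2*k" using assms(2,3) by auto
  then show "t (2*i - 1) < s (2*i - 1)" "s (2*i) < t (2*i)"
    using assms(1) unfolding box_inside_def by (meson dvd_triv_left)+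
qed

lemma admissible_box_inside:
  assumes "admissible k s" "box_inside k s t"
  shows "admissible k t"
  using assms box_insideD[OF assms(2)] unfolding admissible_def by (meson order.strict_trans)

lemma box_volume_mono:
  assumes "admissible k s" "box_inside k s t"
  shows "box_volume k s \<le> box_volume k t"
  unfolding box_volume_def
proof (rule prod_mono)
  fix i assume "i \<in> {1..k-1}"
  then have "1 \<le> i" "i < k" by auto
  then show "0 \<le> s (2*i) - s (2*i - 1) \<and> s (2*i) - s (2*i - 1) \<le> t (2*i) - t (2*i - 1)"
    using assms(1) box_insideD[OF assms(2), of i] unfolding admissible_def by fastforce
qed

definition widen :: "real \<Rightarrow> (nat \<Rightarrow> real) \<Rightarrow> nat \<Rightarrow> real" where
  "widen \<delta> s n = (if odd n then s n - \<delta> else s n + \<delta>)"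

lemma box_inside_widen:
  assumes "0 < \<delta>"
  shows "box_inside k s (widen \<delta> s)" "box_inside k (widen (- \<delta>) s) s"
  using assms by (simp_all add: box_inside_def widen_def)

lemma tendsto_box_volume_widen:
  assumes c_lim: "(c \<longlongrightarrow> 0) F"
  shows "((\<lambda>\<delta>. box_volume k (widen (c \<delta>) s)) \<longlongrightarrow> box_volume k s) F"
proof -
  have "((\<lambda>\<delta>. widen (c \<delta>) s n) \<longlongrightarrow> s n) F" for n
    using tendsto_diff[OF tendsto_const c_lim, of "s n"] tendsto_add[OF tendsto_const c_lim, of "s n"]
    by (cases "odd n") (simp_all add: widen_def)
  then show ?thesis unfolding box_volume_def by (intro tendsto_intros)
qed

lemma eventually_admissible_widen:
  assumes "admissible k s"
  shows "\<forall>\<^sub>F \<delta> in at_right 0. admissible k (widen (- \<delta>) s)"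
proof -
  have "\<forall>\<^sub>F \<delta> in at_right 0. 2 * \<delta> < s (2*i) - s (2*i - 1)" if "i \<in> {1..<k}" for i
  proof (rule order_tendstoD(2))
    show "((\<lambda>\<delta>. 2 * \<delta>) \<longlongrightarrow> 2 * 0) (at_right (0 :: real))" by (intro tendsto_intros)
    show "2 * 0 < s (2*i) - s (2*i - 1)" using assms that by (simp add: admissible_def)
  qed
  then have "\<forall>\<^sub>F \<delta> in at_right 0. \<forall>i\<in>{1..<k}. 2 * \<delta> < s (2*i) - s (2*i - 1)"
    by (intro eventually_ball_finite) auto
  then show ?thesis
    by eventually_elim (auto simp: admissible_def widen_def algebra_simps)
qed

text \<open>Indexes rational boxes by a countable type, so that almost sure statements about all of them
  can be intersected.\<close>

definition list_seq :: "rat list \<Rightarrow> nat \<Rightarrow> real" where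
  "list_seq L n = (if n < length L then of_rat (L ! n) else 0)"

lemma list_seq_between:
  assumes "box_inside k s t"
  shows "\<exists>L. box_inside k s (list_seq L) \<and> box_inside k (list_seq L) t"
proof -
  have "\<exists>q. if odd n then t n < of_rat q \<and> of_rat q < s n else s n < of_rat q \<and> of_rat q < t n"
    if "n < 2*k" for n
    using assms that of_rat_dense by (cases "odd n") (auto simp: box_inside_def)
  then obtain f where f_between: "\<And>n. n < 2*k \<Longrightarrow>
      if odd n then t n < of_rat (f n) \<and> of_rat (f n) < s n else s n < of_rat (f n) \<and> of_rat (f n) < t n"
    by metis
  have list_seq_eq: "list_seq (map f [0..<2*k]) n = of_rat (f n)" if "n < 2*k" for n
    using that by (simp add: list_seq_def)
  show ?thesis
  proof (intro exI conjI)
    show "box_inside k s (list_seq (map f [0..<2*k]))" "box_inside k (list_seq (map f [0..<2*k])) t"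
      unfolding box_inside_def using list_seq_eq f_between by (metis (full_types))+
  qed
qed

lemma corr_count_mono:
  assumes "N \<le> N'" and "\<And>i. 1 \<le> i \<Longrightarrow> i < k \<Longrightarrow> s' (2*i - 1) / real N' \<le> s (2*i - 1) / real N"
    and "\<And>i. 1 \<le> i \<Longrightarrow> i < k \<Longrightarrow> s (2*i) / real N \<le> s' (2*i) / real N'"
  shows "corr_count k y s N \<le> corr_count k y s' N'"
  unfolding corr_count_def
proof (rule card_mono)
  let ?hit = "\<lambda>s N as i. in_box s N i (y (as ! 0) - y (as ! i))"
  show "finite {as \<in> tuples k N'. \<forall>i\<in>{1..k-1}. ?hit s' N' as i}"
    using finite_tuples by simp
  show "{as \<in> tuples k N. \<forall>i\<in>{1..k-1}. ?hit s N as i}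
      \<subseteq> {as \<in> tuples k N'. \<forall>i\<in>{1..k-1}. ?hit s' N' as i}"
  proof clarify
    fix as assume as_mem: "as \<in> tuples k N" and hits: "\<forall>i\<in>{1..k-1}. ?hit s N as i"
    have "as \<in> tuples k N'" using as_mem assms(1) by (auto simp: tuples_def)
    moreover have "?hit s' N' as i" if "i \<in> {1..k-1}" for i
    proof -
      have i_range: "1 \<le> i" "i < k" using that by auto
      show ?thesis
        by (rule in_mod1_mono[OF bspec[OF hits that] assms(2)[OF i_range] assms(3)[OF i_range]])
    qed
    ultimately show "as \<in> tuples k N' \<and> (\<forall>i\<in>{1..k-1}. ?hit s' N' as i)" by blast
  qed
qed

lemma eventually_corr_count_le:
  assumes inside: "box_inside k s t" and A_le_B: "\<And>N. A N \<le> B N"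
    and A_pos: "\<forall>\<^sub>F N in sequentially. 0 < A N"
    and ratio: "(\<lambda>N. real (B N) / real (A N)) \<longlonglongrightarrow> 1"
  shows "\<forall>\<^sub>F N in sequentially. corr_count k y s (A N) \<le> corr_count k y t (B N)"
proof -
  have "\<forall>\<^sub>F N in sequentially.
      if odd n then t n < s n * (real (B N) / real (A N)) else s n * (real (B N) / real (A N)) < t n"
    if "n < 2*k" for n
    using order_tendstoD[OF tendsto_mult_left[OF ratio, of "s n"]] inside that
    by (cases "odd n") (auto simp: box_inside_def)
  then have "\<forall>\<^sub>F N in sequentially. \<forall>n\<in>{..<2*k}.
      if odd n then t n < s n * (real (B N) / real (A N)) else s n * (real (B N) / real (A N)) < t n"
    by (intro eventually_ball_finite) auto
  with A_pos show ?thesis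
  proof eventually_elim
    case (elim N)
    then have scaled_inside: "box_inside k (\<lambda>n. s n * (real (B N) / real (A N))) t"
      unfolding box_inside_def by blast
    have A_N_pos: "0 < real (A N)" and B_N_pos: "0 < real (B N)" using elim(1) A_le_B[of N] by auto
    show ?case
    proof (rule corr_count_mono[OF A_le_B])
      fix i assume i_range: "1 \<le> i" "i < k"
      show "t (2*i - 1) / real (B N) \<le> s (2*i - 1) / real (A N)"
        "s (2*i) / real (A N) \<le> t (2*i) / real (B N)"
        using box_insideD[OF scaled_inside i_range] A_N_pos B_N_pos by (simp_all add: field_simps)
    qed
  qed
qed

lemma filterlim_floor_sqrt: "filterlim floor_sqrt at_top sequentially"
  unfolding filterlim_at_top
proof
  fix Z
  have "\<forall>\<^sub>F N in sequentially. Z\<^sup>2 \<le> N" by (rule eventually_ge_at_top)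
  then show "\<forall>\<^sub>F N in sequentially. Z \<le> floor_sqrt N" by eventually_elim (rule le_floor_sqrtI)
qed

lemma tendsto_floor_sqrt_over_sqrt: "(\<lambda>N. real (floor_sqrt N) / sqrt (real N)) \<longlonglongrightarrow> 1"
proof (rule tendsto_sandwich)
  have lower: "sqrt (real N) - 1 \<le> real (floor_sqrt N)" for N
  proof -
    have "real N \<le> (real (Suc (floor_sqrt N)))\<^sup>2"
      using Suc_floor_sqrt_power2_gt[of N] by (simp only: of_nat_power[symmetric] of_nat_le_iff)
    then have "sqrt (real N) \<le> real (Suc (floor_sqrt N))" by (rule real_le_lsqrt[rotated]) simp
    then show ?thesis by simp
  qed
  have upper: "real (floor_sqrt N) \<le> sqrt (real N)" for N
  proof (rule real_le_rsqrt)
    show "(real (floor_sqrt N))\<^sup>2 \<le> real N"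
      using floor_sqrt_power2_le[of N] by (simp only: of_nat_power[symmetric] of_nat_le_iff)
  qed
  show "\<forall>\<^sub>F N in sequentially. (sqrt (real N) - 1) / sqrt (real N)
      \<le> real (floor_sqrt N) / sqrt (real N)"
    using lower by (intro always_eventually allI divide_right_mono) auto
  show "\<forall>\<^sub>F N in sequentially. real (floor_sqrt N) / sqrt (real N) \<le> 1"
    using eventually_gt_at_top[of 0] by eventually_elim (simp add: upper)
  show "(\<lambda>N. (sqrt (real N) - 1) / sqrt (real N)) \<longlonglongrightarrow> 1" by real_asymp
qed simp

lemma tendsto_floor_sqrt_square_ratios:
  "(\<lambda>N. real ((floor_sqrt N)\<^sup>2) / real N) \<longlonglongrightarrow> 1"
  "(\<lambda>N. real ((Suc (floor_sqrt N))\<^sup>2) / real N) \<longlonglongrightarrow> 1"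
proof -
  have "(\<lambda>N. 1 / sqrt (real N)) \<longlonglongrightarrow> 0" by real_asymp
  note tendsto_power[OF tendsto_add[OF tendsto_floor_sqrt_over_sqrt this], of 2]
    tendsto_power[OF tendsto_floor_sqrt_over_sqrt, of 2]
  then show "(\<lambda>N. real ((floor_sqrt N)\<^sup>2) / real N) \<longlonglongrightarrow> 1"
    "(\<lambda>N. real ((Suc (floor_sqrt N))\<^sup>2) / real N) \<longlonglongrightarrow> 1"
    by (simp_all add: power_divide add.commute flip: add_divide_distrib)
qed

lemma tendsto_over_of_squares:
  fixes f :: "nat \<Rightarrow> real"
  assumes f_lim: "(\<lambda>j. f (j\<^sup>2) / real (j\<^sup>2)) \<longlonglongrightarrow> v" and q_lim: "filterlim q at_top sequentially"
    and ratio: "(\<lambda>N. real ((q N)\<^sup>2) / real N) \<longlonglongrightarrow> 1"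
  shows "(\<lambda>N. f ((q N)\<^sup>2) / real N) \<longlonglongrightarrow> v"
proof -
  have "\<forall>\<^sub>F N in sequentially. 0 < q N"
    using eventually_compose_filterlim[OF eventually_gt_at_top q_lim] .
  then have "\<forall>\<^sub>F N in sequentially. f ((q N)\<^sup>2) / real ((q N)\<^sup>2) * (real ((q N)\<^sup>2) / real N)
      = f ((q N)\<^sup>2) / real N"
    by eventually_elim simp
  moreover have "(\<lambda>N. f ((q N)\<^sup>2) / real ((q N)\<^sup>2) * (real ((q N)\<^sup>2) / real N)) \<longlonglongrightarrow> v"
    using tendsto_mult[OF filterlim_compose[OF f_lim q_lim] ratio] by simp
  ultimately show ?thesis by (rule Lim_transform_eventually[rotated])
qed

definition corr_square_limit :: "nat \<Rightarrow> (nat \<Rightarrow> real) \<Rightarrow> (nat \<Rightarrow> real) \<Rightarrow> bool" where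
  "corr_square_limit k y s \<longleftrightarrow> (\<lambda>j. real (corr_count k y s (j\<^sup>2)) / real (j\<^sup>2)) \<longlonglongrightarrow> box_volume k s"

lemma eventually_corr_count_less:
  assumes inside: "box_inside k s t" and lim: "corr_square_limit k y t"
    and volume_less: "box_volume k t < a"
  shows "\<forall>\<^sub>F N in sequentially. real (corr_count k y s N) / real N < a"
proof -
  let ?M = "\<lambda>N. (Suc (floor_sqrt N))\<^sup>2"
  have "(\<lambda>N. real (corr_count k y t (?M N)) / real N) \<longlonglongrightarrow> box_volume k t"
    using lim filterlim_compose[OF filterlim_Suc filterlim_floor_sqrt] tendsto_floor_sqrt_square_ratios(2)
    unfolding corr_square_limit_def by (rule tendsto_over_of_squares)
  from order_tendstoD(2)[OF this volume_less]
  have "\<forall>\<^sub>F N in sequentially. real (corr_count k y t (?M N)) / real N < a" .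
  moreover have "\<forall>\<^sub>F N in sequentially. corr_count k y s N \<le> corr_count k y t (?M N)"
    using inside less_imp_le[OF Suc_floor_sqrt_power2_gt] eventually_gt_at_top
      tendsto_floor_sqrt_square_ratios(2)
    by (rule eventually_corr_count_le)
  ultimately show ?thesis
    by eventually_elim (meson divide_right_mono le_less_trans of_nat_0_le_iff of_nat_mono)
qed

lemma eventually_corr_count_greater:
  assumes inside: "box_inside k t s" and lim: "corr_square_limit k y t"
    and less_volume: "a < box_volume k t"
  shows "\<forall>\<^sub>F N in sequentially. a < real (corr_count k y s N) / real N"
proof -
  let ?M = "\<lambda>N. (floor_sqrt N)\<^sup>2"
  have "(\<lambda>N. real (corr_count k y t (?M N)) / real N) \<longlonglongrightarrow> box_volume k t"
    using lim filterlim_floor_sqrt tendsto_floor_sqrt_square_ratios(1)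
    unfolding corr_square_limit_def by (rule tendsto_over_of_squares)
  from order_tendstoD(1)[OF this less_volume]
  have "\<forall>\<^sub>F N in sequentially. a < real (corr_count k y t (?M N)) / real N" .
  moreover have "\<forall>\<^sub>F N in sequentially. corr_count k y t (?M N) \<le> corr_count k y s N"
  proof (rule eventually_corr_count_le[OF inside floor_sqrt_power2_le])
    show "\<forall>\<^sub>F N in sequentially. 0 < ?M N"
      using eventually_gt_at_top[of 0] by eventually_elim (simp add: floor_sqrt_greater_zero_iff)
    show "(\<lambda>N. real N / real (?M N)) \<longlonglongrightarrow> 1"
      using tendsto_inverse[OF tendsto_floor_sqrt_square_ratios(1)] by simp
  qed
  ultimately show ?thesis
    by eventually_elim (meson divide_right_mono less_le_trans of_nat_0_le_iff of_nat_mono)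
qed

lemma poissonian_corr_of_squares:
  assumes squares: "\<And>L. admissible k (list_seq L) \<Longrightarrow> corr_square_limit k y (list_seq L)"
  shows "poissonian_corr k y"
  unfolding poissonian_corr_iff_box_volume
proof (intro allI impI)
  fix s assume s_admissible: "admissible k s"
  have positive: "\<forall>\<^sub>F \<delta> in at_right (0::real). 0 < \<delta>" by (rule eventually_at_right_less)
  have id_lim: "((\<lambda>\<delta>. \<delta>) \<longlongrightarrow> 0) (at_right (0::real))" by (rule tendsto_ident_at)
  show "(\<lambda>N. real (corr_count k y s N) / real N) \<longlonglongrightarrow> box_volume k s"
  proof (rule order_tendstoI)
    fix a assume "box_volume k s < a"
    from order_tendstoD(2)[OF tendsto_box_volume_widen[OF id_lim] this] positive
    have "\<forall>\<^sub>F \<delta> in at_right 0. box_volume k (widen \<delta> s) < a \<and> 0 < \<delta>" by (rule eventually_conj)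
    then obtain \<delta> where \<delta>_widen: "box_volume k (widen \<delta> s) < a" "0 < \<delta>"
      using eventually_happens'[OF trivial_limit_at_right_real] by blast
    obtain L where L_between: "box_inside k s (list_seq L)" "box_inside k (list_seq L) (widen \<delta> s)"
      using list_seq_between[OF box_inside_widen(1)[OF \<delta>_widen(2)]] by blast
    have "admissible k (list_seq L)" by (rule admissible_box_inside[OF s_admissible L_between(1)])
    moreover have "box_volume k (list_seq L) < a"
      using box_volume_mono[OF calculation L_between(2)] \<delta>_widen(1) by simp
    ultimately show "\<forall>\<^sub>F N in sequentially. real (corr_count k y s N) / real N < a"
      using L_between(1) squares by (intro eventually_corr_count_less) auto
  next
    fix a assume a_less: "a < box_volume k s"
    have "((\<lambda>\<delta>. - \<delta>) \<longlongrightarrow> 0) (at_right (0::real))" using tendsto_minus[OF id_lim] by simp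
    from order_tendstoD(1)[OF tendsto_box_volume_widen[OF this] a_less] positive
      eventually_admissible_widen[OF s_admissible]
    have "\<forall>\<^sub>F \<delta> in at_right 0. a < box_volume k (widen (- \<delta>) s) \<and> 0 < \<delta>
        \<and> admissible k (widen (- \<delta>) s)"
      by eventually_elim blast
    then obtain \<delta> where \<delta>_widen: "a < box_volume k (widen (- \<delta>) s)" "0 < \<delta>"
      "admissible k (widen (- \<delta>) s)"
      using eventually_happens'[OF trivial_limit_at_right_real] by blast
    obtain L where L_between: "box_inside k (widen (- \<delta>) s) (list_seq L)"
      "box_inside k (list_seq L) s"
      using list_seq_between[OF box_inside_widen(2)[OF \<delta>_widen(2)]] by blast
    have "admissible k (list_seq L)" by (rule admissible_box_inside[OF \<delta>_widen(3) L_between(1)])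
    moreover have "a < box_volume k (list_seq L)"
      using box_volume_mono[OF \<delta>_widen(3) L_between(1)] \<delta>_widen(1) by simp
    ultimately show "\<forall>\<^sub>F N in sequentially. a < real (corr_count k y s N) / real N"
      using L_between(2) squares by (intro eventually_corr_count_greater) auto
  qed
qed

section \<open>Almost every dilation\<close>

lemma poissonian_corr_uminus:
  assumes "poissonian_corr k y"
  shows "poissonian_corr k (\<lambda>n. - y n)"
  unfolding poissonian_corr_iff_box_volume
proof (intro allI impI)
  fix s assume s_admissible: "admissible k s"
  define s' where "s' = (\<lambda>n. if even n then - s (n - 1) else - s (n + 1))"
  have s'_eq: "s' (2*i - 1) = - s (2*i)" "s' (2*i) = - s (2*i - 1)" if "1 \<le> i" for i
    using that by (auto simp: s'_def)
  have "admissible k s'" using s_admissible s'_eq by (auto simp: admissible_def)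
  then have "(\<lambda>N. real (corr_count k y s' N) / real N) \<longlonglongrightarrow> box_volume k s'"
    using assms unfolding poissonian_corr_iff_box_volume by blast
  moreover have "s' (2*i) - s' (2*i - 1) = s (2*i) - s (2*i - 1)" if "i \<in> {1..k-1}" for i
    using s'_eq[of i] that by simp
  then have "box_volume k s' = box_volume k s"
    unfolding box_volume_def by (intro prod.cong refl)
  moreover have "corr_count k y s' N = corr_count k (\<lambda>n. - y n) s N" for N
  proof -
    have "in_box s N i (- y (as ! 0) - - y (as ! i)) \<longleftrightarrow> in_box s' N i (y (as ! 0) - y (as ! i))"
      if "i \<in> {1..k-1}" for as i
      using in_mod1_uminus[of "y (as ! 0) - y (as ! i)"] s'_eq[of i] that by simp
    then show ?thesis unfolding corr_count_def
      by (intro arg_cong[of _ _ card] Collect_cong conj_cong refl ball_cong) auto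
  qed
  ultimately show "(\<lambda>N. real (corr_count k (\<lambda>n. - y n) s N) / real N) \<longlonglongrightarrow> box_volume k s"
    by (simp only:)
qed

lemma AE_poissonian_corr_of_pos:
  assumes pos: "AE \<alpha> in lborel. 0 < \<alpha> \<longrightarrow> poissonian_corr k (\<lambda>n. \<alpha> * x n)"
  shows "AE \<alpha> in lborel. poissonian_corr k (\<lambda>n. \<alpha> * x n)"
proof -
  have neg: "AE \<alpha> in lborel. 0 < - 1 * \<alpha> \<longrightarrow> poissonian_corr k (\<lambda>n. - 1 * \<alpha> * x n)"
    using AE_lborel_mult[OF _ pos, of "- 1"] by simp
  have "AE \<alpha> in lborel. \<alpha> \<noteq> (0::real)" by (rule AE_lborel_singleton)
  with pos neg show ?thesis
  proof eventually_elim
    case (elim \<alpha>)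
    show ?case
    proof (cases "0 < \<alpha>")
      case False
      with elim have "poissonian_corr k (\<lambda>n. - (\<alpha> * x n))" by simp
      from poissonian_corr_uminus[OF this] show ?thesis by simp
    qed (use elim in blast)
  qed
qed

lemma pred_corr_square_limit:
  "Measurable.pred (lborel \<Otimes>\<^sub>M Unif)
     (\<lambda>p. 0 < fst p \<longrightarrow> corr_square_limit k (\<lambda>n. fst p * perturbed_seq G (snd p) n) s)"
proof -
  have [measurable]: "(\<lambda>p. snd p n) \<in> borel_measurable (lborel \<Otimes>\<^sub>M Unif)" for n
    using measurable_compose[OF measurable_snd measurable_Unif_component] .
  have [measurable]: "fst \<in> borel_measurable (lborel \<Otimes>\<^sub>M Unif)"
    using measurable_fst[of lborel Unif] by (simp cong: measurable_cong_sets)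
  have "(\<lambda>p. real (corr_count k (\<lambda>n. fst p * perturbed_seq G (snd p) n) s N))
      = (\<lambda>p. \<Sum>as\<in>tuples k N. if \<forall>i\<in>{1..k-1}. in_box s N i
          (fst p * perturbed_seq G (snd p) (as ! 0) - fst p * perturbed_seq G (snd p) (as ! i))
          then 1 else 0)" for N
    using finite_tuples[of k N] by (simp add: corr_count_def sum.If_cases Int_def)
  then have [measurable]: "(\<lambda>p. real (corr_count k (\<lambda>n. fst p * perturbed_seq G (snd p) n) s N))
      \<in> borel_measurable (lborel \<Otimes>\<^sub>M Unif)" for N
    unfolding perturbed_seq_def by simp measurable
  show ?thesis unfolding corr_square_limit_def by measurable
qed

lemma (in khinchin_perturbation) AE_corr_square_limit:
  assumes k_ge_1: "1 \<le> k" and s_admissible: "admissible k s"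
  shows "AE \<omega> in Unif. AE \<alpha> in lborel. 0 < \<alpha> \<longrightarrow> corr_square_limit k (\<lambda>n. \<alpha> * perturbed_seq G \<omega> n) s"
proof -
  interpret pair: pair_sigma_finite lborel Unif ..
  let ?Q = "\<lambda>\<alpha> \<omega>. 0 < \<alpha> \<longrightarrow> corr_square_limit k (\<lambda>n. \<alpha> * perturbed_seq G \<omega> n) s"
  have "AE \<alpha> in lborel. khinchin_type \<psi> (2 * \<alpha>)"
    by (rule AE_lborel_mult[OF _ AE_khinchin_type[OF \<psi>_ge_1 \<psi>_summable]]) simp
  then have "AE \<alpha> in lborel. AE \<omega> in Unif. ?Q \<alpha> \<omega>"
  proof eventually_elim
    case (elim \<alpha>)
    show ?case
    proof (cases "0 < \<alpha>")
      case True
      interpret perturbed_rotation \<psi> G \<alpha> by unfold_locales (use True elim in auto)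
      show ?thesis using AE_corr_count_squares[OF k_ge_1 s_admissible]
        by (simp add: corr_square_limit_def point_def[abs_def])
    qed simp
  qed
  moreover have "{p \<in> space (lborel \<Otimes>\<^sub>M Unif). ?Q (fst p) (snd p)} \<in> sets (lborel \<Otimes>\<^sub>M Unif)"
    using pred_corr_square_limit by (rule predE)
  ultimately show ?thesis by (simp only: pair.AE_commute)
qed

lemma (in khinchin_perturbation) AE_poissonian_corr:
  shows "AE \<omega> in Unif. AE \<alpha> in lborel. \<forall>k\<ge>2. poissonian_corr k (\<lambda>n. \<alpha> * perturbed_seq G \<omega> n)"
proof -
  let ?Q = "\<lambda>k L \<alpha> \<omega>. 2 \<le> k \<and> admissible k (list_seq L) \<longrightarrow> 0 < \<alpha> \<longrightarrow>
     corr_square_limit k (\<lambda>n. \<alpha> * perturbed_seq G \<omega> n) (list_seq L)"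
  have "AE \<omega> in Unif. AE \<alpha> in lborel. ?Q k L \<alpha> \<omega>" for k L
  proof (cases "2 \<le> k \<and> admissible k (list_seq L)")
    case True
    then have "1 \<le> k" "admissible k (list_seq L)" by auto
    from AE_corr_square_limit[OF this] show ?thesis using True by simp
  qed auto
  then have "AE \<omega> in Unif. \<forall>k L. AE \<alpha> in lborel. ?Q k L \<alpha> \<omega>"
    unfolding AE_all_countable by blast
  then show ?thesis
  proof eventually_elim
    case (elim \<omega>)
    then have squares: "AE \<alpha> in lborel. \<forall>k L. ?Q k L \<alpha> \<omega>"
      unfolding AE_all_countable .
    have "AE \<alpha> in lborel. poissonian_corr k (\<lambda>n. \<alpha> * perturbed_seq G \<omega> n)" if "2 \<le> k" for k
    proof (rule AE_poissonian_corr_of_pos)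
      show "AE \<alpha> in lborel. 0 < \<alpha> \<longrightarrow> poissonian_corr k (\<lambda>n. \<alpha> * perturbed_seq G \<omega> n)"
        using squares by eventually_elim (use that in \<open>auto intro: poissonian_corr_of_squares\<close>)
    qed
    then show ?case by (simp add: AE_all_countable)
  qed
qed

lemma AE_Unif_bounded: "AE \<omega> in Unif. \<forall>n. 0 \<le> \<omega> n \<and> \<omega> n \<le> 1"
proof -
  have "AE x in unif. 0 \<le> x \<and> x \<le> 1" by (rule AE_uniform_measureI) auto
  then have "AE \<omega> in Unif. 0 \<le> \<omega> n \<and> \<omega> n \<le> 1" for n
    by (intro AE_PiM_component[where P = "\<lambda>x. 0 \<le> x \<and> x \<le> 1"]) (auto intro: prob_space_unif)
  then show ?thesis unfolding AE_all_countable by blast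
qed

lemma AE_perturb_scale_poissonian:
  assumes "c > 0"
  shows "AE \<omega> in Unif. AE \<alpha> in lborel. \<forall>k\<ge>2.
     poissonian_corr k (\<lambda>n. \<alpha> * perturbed_seq (perturb_scale c) \<omega> n)"
proof -
  interpret khinchin_perturbation "\<lambda>q. loglog_weight (1 + c / 3) (real q)" "perturb_scale c"
    using assms filterlim_perturb_scale_over_weight[OF assms]
    by unfold_locales (auto intro!: mono_loglog_weight loglog_weight_ge_1
        summable_inverse_loglog_weight perturb_scale_pos tendsto_perturb_scale)
  show ?thesis by (rule AE_poissonian_corr)
qed

section \<open>Additive energy\<close>

lemma cube_le_additive_energy:
  fixes d g \<gamma> :: real
  assumes M_range: "1 \<le> M" "M + 3 * m \<le> N" and g_small: "2 * g < \<gamma>"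
    and x_near: "\<And>n. M \<le> n \<Longrightarrow> n < M + 3 * m \<Longrightarrow> d * real n \<le> x n \<and> x n \<le> d * real n + g"
  shows "m ^ 3 \<le> additive_energy x N \<gamma>"
proof -
  let ?f = "\<lambda>(p, q, r). (M + m + p, M + m + q, M + m + r, M + m + p + q - r)"
  let ?S = "{(a, b, c, d). a \<in> {1..N} \<and> b \<in> {1..N} \<and> c \<in> {1..N} \<and> d \<in> {1..N}
      \<and> \<bar>x a + x b - x c - x d\<bar> < \<gamma>}"
  let ?D = "{..<m} \<times> {..<m} \<times> {..<m}"
  have "inj_on ?f ?D" by (auto simp: inj_on_def)
  moreover have "?f ` ?D \<subseteq> ?S"
  proof clarify
    fix p q r assume pqr_less: "p < m" "q < m" "r < m"
    define a b c e where "a = M + m + p" "b = M + m + q" "c = M + m + r" "e = M + m + p + q - r"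
    note quadruple_eq = this
    have "d * real n \<le> x n \<and> x n \<le> d * real n + g" if "n \<in> {a, b, c, e}" for n
      using that pqr_less by (intro x_near) (auto simp: quadruple_eq)
    then have "d * real a \<le> x a \<and> x a \<le> d * real a + g" "d * real b \<le> x b \<and> x b \<le> d * real b + g"
      "d * real c \<le> x c \<and> x c \<le> d * real c + g" "d * real e \<le> x e \<and> x e \<le> d * real e + g"
      by blast+
    moreover have "real a + real b = real c + real e"
      using pqr_less by (simp add: quadruple_eq of_nat_diff)
    then have "d * real a + d * real b = d * real c + d * real e"
      by (simp only: distrib_left[symmetric])
    ultimately have "\<bar>x a + x b - x c - x e\<bar> < \<gamma>" using g_small by linarith
    moreover have "{a, b, c, e} \<subseteq> {1..N}" using pqr_less M_range by (auto simp: quadruple_eq)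
    ultimately show "M + m + p \<in> {1..N} \<and> M + m + q \<in> {1..N} \<and> M + m + r \<in> {1..N} \<and>
       M + m + p + q - r \<in> {1..N} \<and>
       \<bar>x (M + m + p) + x (M + m + q) - x (M + m + r) - x (M + m + p + q - r)\<bar> < \<gamma>"
      unfolding quadruple_eq by simp
  qed
  moreover have "finite ?S"
    by (rule finite_subset[of _ "{1..N} \<times> {1..N} \<times> {1..N} \<times> {1..N}"]) auto
  ultimately have "card ?D \<le> card ?S" by (rule card_inj_on_le)
  then show ?thesis
    unfolding additive_energy_def by (simp add: power3_eq_cube card_cartesian_product)
qed

lemma perturbed_seq_bounds:
  assumes "0 \<le> \<omega> n" "\<omega> n \<le> 1" "0 \<le> G (floor_log n)"
  shows "2 * real n \<le> perturbed_seq G \<omega> n" "perturbed_seq G \<omega> n \<le> 2 * real n + G (floor_log n)"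
  using assms by (simp_all add: perturbed_seq_def mult_left_le)

lemma perturbed_seq_gap:
  assumes "\<And>n. 0 \<le> \<omega> n \<and> \<omega> n \<le> 1" "\<And>j. 0 \<le> G j \<and> G j \<le> 1"
  shows "perturbed_seq G \<omega> (Suc n) - perturbed_seq G \<omega> n \<ge> 1"
  using perturbed_seq_bounds[of \<omega> n G] perturbed_seq_bounds[of \<omega> "Suc n" G] assms(1)
    assms(2)[of "floor_log n"] assms(2)[of "floor_log (Suc n)"] by force

lemma eventually_additive_energy_perturbed_seq:
  assumes \<omega>_bounds: "\<And>n. 0 \<le> \<omega> n \<and> \<omega> n \<le> 1" and G_nonneg: "\<And>j. 0 \<le> G j"
    and \<gamma>_large: "\<forall>\<^sub>F N in sequentially. 2 * G (floor_log N - 1) < \<gamma> N"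
  shows "\<forall>\<^sub>F N in sequentially. 1 / 4096 * real N ^ 3
      \<le> real (additive_energy (perturbed_seq G \<omega>) N (\<gamma> N))"
  using \<gamma>_large eventually_ge_at_top[of "2 ^ 3"]
proof eventually_elim
  case (elim N)
  have "3 \<le> floor_log N" using floor_log_le_iff[OF elim(2)] by (simp only: floor_log_power)
  then obtain i where i_eq: "floor_log N = i + 3" by (metis add.commute le_Suc_ex)
  define m where "m = (2::nat) ^ i"
  have m_bounds: "1 \<le> m" "8 * m \<le> N" "N < 16 * m"
    using floor_log_exp2_le[of N] floor_log_exp2_gt[of N] elim(2)
    unfolding i_eq m_def by (auto simp: power_add)
  have "m ^ 3 \<le> additive_energy (perturbed_seq G \<omega>) N (\<gamma> N)"
  proof (rule cube_le_additive_energy[where d = 2])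
    show "2 * G (i + 2) < \<gamma> N" using elim(1) by (simp add: i_eq)
    fix n assume n_range: "4 * m \<le> n" "n < 4 * m + 3 * m"
    have "floor_log n = i + 2" using n_range m_bounds by (intro floor_log_eqI) (auto simp: m_def)
    then show "2 * real n \<le> perturbed_seq G \<omega> n \<and> perturbed_seq G \<omega> n \<le> 2 * real n + G (i + 2)"
      using perturbed_seq_bounds[of \<omega> n G] \<omega>_bounds G_nonneg by simp
  qed (use m_bounds in auto)
  then have "real m ^ 3 \<le> real (additive_energy (perturbed_seq G \<omega>) N (\<gamma> N))"
    by (simp only: of_nat_power[symmetric] of_nat_le_iff)
  moreover have "real N ^ 3 \<le> (16 * real m) ^ 3" using m_bounds by (intro power_mono) auto
  then have "real N ^ 3 \<le> 4096 * real m ^ 3" by (simp add: power_mult_distrib)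
  ultimately show ?case by linarith
qed

theorem theorem4:
  fixes c :: real
  assumes "c > 0"
  shows "\<exists>x :: nat \<Rightarrow> real.
           (\<forall>n\<ge>1. x n < x (Suc n) \<and> x (Suc n) - x n \<ge> 1)
         \<and> (\<exists>C>0. \<forall>\<^sub>F N in sequentially.
                real (additive_energy x N (gammaN c N)) \<ge> C * real N ^ 3)
         \<and> (AE \<alpha> in lborel. \<forall>k\<ge>2. poissonian_corr k (\<lambda>n. \<alpha> * x n))"
proof -
  let ?G = "perturb_scale c"
  have G_bounds: "0 \<le> ?G j" "?G j \<le> 1" for j
    using perturb_scale_pos[OF assms] perturb_scale_le_1 by (auto intro: less_imp_le)
  have "AE \<omega> in Unif. (\<forall>n. 0 \<le> \<omega> n \<and> \<omega> n \<le> 1) \<and>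
      (AE \<alpha> in lborel. \<forall>k\<ge>2. poissonian_corr k (\<lambda>n. \<alpha> * perturbed_seq ?G \<omega> n))"
    using AE_Unif_bounded AE_perturb_scale_poissonian[OF assms] by (rule eventually_conj)
  then obtain \<omega> where \<omega>_bounds: "\<And>n. 0 \<le> \<omega> n \<and> \<omega> n \<le> 1"
    and poisson: "AE \<alpha> in lborel. \<forall>k\<ge>2. poissonian_corr k (\<lambda>n. \<alpha> * perturbed_seq ?G \<omega> n)"
    using eventually_happens'[OF Unif.P.ae_filter_bot] by blast
  have gap: "perturbed_seq ?G \<omega> (Suc n) - perturbed_seq ?G \<omega> n \<ge> 1" for n
    using \<omega>_bounds G_bounds by (intro perturbed_seq_gap) auto
  then have "perturbed_seq ?G \<omega> n < perturbed_seq ?G \<omega> (Suc n)" for n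
    using less_le_trans[OF zero_less_one gap[of n]] by simp
  moreover have "\<forall>\<^sub>F N in sequentially. 1 / 4096 * real N ^ 3
      \<le> real (additive_energy (perturbed_seq ?G \<omega>) N (gammaN c N))"
    using \<omega>_bounds G_bounds(1) eventually_perturb_scale_less_gammaN[OF assms]
    by (rule eventually_additive_energy_perturbed_seq)
  then have "\<exists>C>0. \<forall>\<^sub>F N in sequentially. C * real N ^ 3
      \<le> real (additive_energy (perturbed_seq ?G \<omega>) N (gammaN c N))"
    by (intro exI[of _ "1 / 4096"]) simp
  ultimately show ?thesis using gap poisson by blast
qed

end
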